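(* Let $f(z)=\sum_{k\ge 0}a_kz^k\in\mathbb{Z}[[z]]$ be a generalized Liouville series with convergence radius $R_f>0$, with associated integer sequences $(s_n)_{n\ge1}$ and $(t_n)_{n\ge0}$, and for $n\ge1$ put $P_n(z)=\sum_{k=t_{n-1}}^{s_n}a_kz^k$. Let $\alpha$ be a simple algebraic integer of degree $m$ satisfying $|\alpha|<R_f$. Assume that $P_n(\alpha)\ne0$ for infinitely many $n$. Then $f(\alpha)$ is a $U_m$-number, that is, $f(\alpha)\in U_m$.
   Context: Throughout, power series $f(z)=\sum_{k\ge0}a_kz^k$ have integer coefficients, positive radius of convergence $R_f$, and infinitely many non-zero coefficients. Such an $f$ is called a generalized Liouville series if there exist integer sequences $(s_n)_{n\ge1}$, $(t_n)_{n\ge0}$ such that: $0\le t_0\le s_1<t_1\le s_2<t_2\le s_3<\cdots$ (that is, $t_{n-1}\le s_n<t_n$ for all $n\ge1$); $a_k=0$ for $k<t_0$ and for $s_n<k<t_n$ ($n=1,2,\ldots$); $t_n/s_n\to\infty$ as $n\to\infty$; and the quotients $s_{n+1}/t_n$ ($n\ge1$) are bounded. Algebraic numbers are complex algebraic numbers, and the degree is the degree over $\mathbb{Q}$. An algebraic number $\alpha$ is called simple if the number field $\mathbb{Q}(\alpha)$ has no proper subfield other than $\mathbb{Q}$: $\mathbb{Q}\subset K\subset\mathbb{Q}(\alpha)$ implies $K=\mathbb{Q}$ or $K=\mathbb{Q}(\alpha)$. For a complex algebraic number $\beta$, its minimal polynomial $M_\beta(T)\in\mathbb{Z}[T]$ is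 the polynomial, irreducible in the ring $\mathbb{Z}[T]$, vanishing at $\beta$ (unique up to sign); $|M_\beta|$ denotes the maximum of the absolute values of its coefficients. For a positive integer $m$, $U_m$ is the set of complex transcendental numbers $\gamma$ such that $m$ is the smallest positive integer with the property: for every $w>0$ there exist infinitely many complex algebraic numbers $\beta$ of degree $m$ satisfying $|\gamma-\beta|<|M_\beta|^{-w}$. *)

theory Defs
  imports
    "HOL-Algebra.Algebraic_Closure_Type"
    "HOL-Algebra.Generated_Fields"
    "HOL-Analysis.FPS_Convergence"
begin

(* The entry s 0 is never used.  All indices are non-negative because 0 <= t 0, so the
   sequences are taken in nat.  Only s 1 can vanish, and then t 1 / s 1 = 0 in HOL, which
   does not affect the limit. *)
definition generalized_liouville ::
    "complex fps \<Rightarrow> (nat \<Rightarrow> nat) \<Rightarrow> (nat \<Rightarrow> nat) \<Rightarrow> bool" where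
  "generalized_liouville f s t \<longleftrightarrow>
     (\<forall>k. fps_nth f k \<in> \<int>) \<and>
     fps_conv_radius f > 0 \<and>
     infinite {k. fps_nth f k \<noteq> 0} \<and>
     (\<forall>n\<ge>1. t (n - 1) \<le> s n \<and> s n < t n) \<and>
     (\<forall>k<t 0. fps_nth f k = 0) \<and>
     (\<forall>n\<ge>1. \<forall>k. s n < k \<and> k < t n \<longrightarrow> fps_nth f k = 0) \<and>
     filterlim (\<lambda>n. real (t n) / real (s n)) at_top sequentially \<and>
     (\<exists>C. \<forall>n\<ge>1. real (s (n + 1)) / real (t n) \<le> C)"

definition block_poly ::
    "complex fps \<Rightarrow> (nat \<Rightarrow> nat) \<Rightarrow> (nat \<Rightarrow> nat) \<Rightarrow> nat \<Rightarrow> complex poly" where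
  "block_poly f s t n = (\<Sum>k = t (n - 1)..s n. Polynomial.monom (fps_nth f k) k)"

abbreviation complex_field :: "complex ring" where
  "complex_field \<equiv> ring_of_type_algebra"

abbreviation rat_adjoin :: "complex \<Rightarrow> complex set" where
  "rat_adjoin \<alpha> \<equiv> generate_field complex_field {\<alpha>}"

definition simple_algebraic :: "complex \<Rightarrow> bool" where
  "simple_algebraic \<alpha> \<longleftrightarrow>
     algebraic \<alpha> \<and>
     (\<forall>K. subfield K complex_field \<and> \<rat> \<subseteq> K \<and> K \<subseteq> rat_adjoin \<alpha>
        \<longrightarrow> K = \<rat> \<or> K = rat_adjoin \<alpha>)"

(* The minimal polynomials below are meant for algebraic arguments only. *)
definition rat_minpoly :: "complex \<Rightarrow> rat poly" where
  "rat_minpoly \<beta> =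
     (THE p. Factorial_Ring.irreducible p \<and> Polynomial.lead_coeff p = 1 \<and>
             poly (map_poly of_rat p) \<beta> = 0)"

definition algebraic_degree :: "complex \<Rightarrow> nat" where
  "algebraic_degree \<beta> = Polynomial.degree (rat_minpoly \<beta>)"

(* M_beta is unique up to sign; the choice of sign does not influence its height. *)
definition int_minpoly :: "complex \<Rightarrow> int poly" where
  "int_minpoly \<beta> =
     (SOME p. Factorial_Ring.irreducible p \<and> poly (map_poly of_int p) \<beta> = 0)"

definition poly_height :: "int poly \<Rightarrow> int" where
  "poly_height p = Max ((\<lambda>i. \<bar>Polynomial.coeff p i\<bar>) ` {..Polynomial.degree p})"

definition well_approximable :: "nat \<Rightarrow> complex \<Rightarrow> bool" where
  "well_approximable m \<gamma> \<longleftrightarrow>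
     (\<forall>w::real. w > 0 \<longrightarrow>
        infinite {\<beta>::complex. algebraic \<beta> \<and> algebraic_degree \<beta> = m \<and>
                   norm (\<gamma> - \<beta>) < real_of_int (poly_height (int_minpoly \<beta>)) powr (- w)})"

definition U_numbers :: "nat \<Rightarrow> complex set" where
  "U_numbers m =
     {\<gamma>. \<not> algebraic \<gamma> \<and> m \<ge> 1 \<and> well_approximable m \<gamma> \<and>
         (\<forall>k. 1 \<le> k \<and> k < m \<longrightarrow> \<not> well_approximable k \<gamma>)}"

end

theory Submission
  imports Defs
begin

text \<open>
  The partial sums \<open>\<beta>\<^sub>n\<close> of \<open>f(\<alpha>)\<close> up to index \<open>s\<^sub>n\<close> lie in \<open>\<int>[\<alpha>]\<close>. Their
  coordinates with respect to the powers of \<open>\<alpha>\<close> grow at most like \<open>L ^ s\<^sub>n\<close>, while the error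
  \<open>\<bar>f(\<alpha>) - \<beta>\<^sub>n\<bar>\<close> decays like \<open>\<rho> ^ t\<^sub>n\<close> with \<open>\<rho> < 1\<close>. Since \<open>t\<^sub>n / s\<^sub>n\<close> tends to
  infinity, the error is smaller than every fixed negative power of the height of \<open>\<beta>\<^sub>n\<close>.

  This is balanced by a Liouville inequality (\<open>liouville_inequality\<close>): if \<open>\<delta>\<close> is a root of an integer
  polynomial \<open>q\<close> of bounded degree and height \<open>H\<close> with \<open>q(\<beta>\<^sub>n) \<noteq> 0\<close>, then \<open>\<bar>\<beta>\<^sub>n - \<delta>\<bar>\<close> is at
  least a fixed negative power of \<open>H L ^ s\<^sub>n\<close>. Its proof replaces the usual product over conjugates by a
  pigeonhole argument, which shows that an element of \<open>\<int>[\<alpha>]\<close> with coordinates at most \<open>E\<close> is a root of a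
  nonzero integer polynomial whose degree is at most \<open>m\<close> and whose height is polynomial in \<open>E\<close>
  (\<open>small_annihilating_poly\<close>). The lowest nonzero coefficient of that polynomial has absolute value at
  least 1, which keeps a nonzero root away from 0; this is applied to \<open>q(\<beta>\<^sub>n)\<close>.

  Three consequences make \<open>f(\<alpha>)\<close> a \<open>U\<^sub>m\<close>-number.

  Transcendence (\<open>transcendental\<close>): if \<open>f(\<alpha>)\<close> were algebraic, the Liouville inequality with
  \<open>\<delta> = f(\<alpha>)\<close> would force \<open>\<beta>\<^sub>n = f(\<alpha>)\<close> for all large \<open>n\<close>, whereas infinitely many of the
  differences \<open>\<beta>\<^sub>n - \<beta>\<^sub>n\<^sub>-\<^sub>1 = P\<^sub>n(\<alpha>)\<close> do not vanish.

  Approximability in degree \<open>m\<close> (\<open>well_approximable_by_degree\<close>): by simplicity of \<open>\<alpha>\<close> the field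
  \<open>\<rat>(\<beta>\<^sub>n)\<close> is \<open>\<rat>\<close> or \<open>\<rat>(\<alpha>)\<close>, so \<open>\<beta>\<^sub>n\<close> has degree \<open>m\<close> unless it is a rational
  integer. It cannot be an integer for all large \<open>n\<close>, since a convergent sequence of integers is
  eventually constant.

  Non-approximability in degree \<open>k < m\<close> (\<open>lower_bound_smaller_degree\<close>): given \<open>\<delta>\<close> of degree \<open>k\<close>
  and height \<open>H\<close>, choose the first large \<open>n\<close> for which \<open>t\<^sub>n\<close> exceeds a suitable multiple of
  \<open>log H\<close>. Then the error \<open>\<bar>f(\<alpha>) - \<beta>\<^sub>n\<bar>\<close> is negligible against the Liouville bound for
  \<open>\<bar>\<beta>\<^sub>n - \<delta>\<bar>\<close>. As \<open>n\<close> is minimal and \<open>s\<^sub>n / t\<^sub>n\<^sub>-\<^sub>1\<close> is bounded, \<open>L ^ s\<^sub>n\<close> is at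
  most a power of \<open>H\<close>. The Liouville bound therefore becomes a fixed negative power of \<open>H\<close>. Here
  \<open>q\<close> is the minimal polynomial of \<open>\<delta>\<close>. If it vanished at \<open>\<beta>\<^sub>n\<close>, then \<open>\<beta>\<^sub>n\<close> would have degree
  \<open>k < m\<close> and so be an integer, equal to \<open>\<delta>\<close>; just finitely many integers \<open>\<delta>\<close> are near
  \<open>f(\<alpha>)\<close>, and they can be set aside.
\<close>

section \<open>Minimal polynomials over the rationals and over the integers\<close>

abbreviation int_poly_at :: "int poly \<Rightarrow> complex \<Rightarrow> complex" where
  "int_poly_at p x \<equiv> poly (map_poly of_int p) x"

abbreviation rat_poly_at :: "rat poly \<Rightarrow> complex \<Rightarrow> complex" where
  "rat_poly_at p x \<equiv> poly (map_poly of_rat p) x"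

lemma int_poly_at_mult: "int_poly_at (p * q) x = int_poly_at p x * int_poly_at q x"
proof -
  have "map_poly of_int (p * q) = (map_poly of_int p * map_poly of_int q :: complex poly)"
    by (intro poly_eqI) (simp add: coeff_mult coeff_map_poly)
  then show ?thesis by simp
qed

lemma int_poly_at_add: "int_poly_at (p + q) x = int_poly_at p x + int_poly_at q x"
proof -
  have "map_poly of_int (p + q) = (map_poly of_int p + map_poly of_int q :: complex poly)"
    by (intro poly_eqI) (simp add: coeff_map_poly)
  then show ?thesis by simp
qed

lemma int_poly_at_smult: "int_poly_at (Polynomial.smult c p) x = of_int c * int_poly_at p x"
proof -
  have "map_poly of_int (Polynomial.smult c p) = Polynomial.smult (of_int c) (map_poly of_int p :: complex poly)"
    by (intro poly_eqI) (simp add: coeff_map_poly)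
  then show ?thesis by simp
qed

lemma rat_poly_at_mult: "rat_poly_at (p * q) x = rat_poly_at p x * rat_poly_at q x"
proof -
  have "map_poly of_rat (p * q) = (map_poly of_rat p * map_poly of_rat q :: complex poly)"
    by (intro poly_eqI) (simp add: coeff_mult coeff_map_poly of_rat_sum of_rat_mult)
  then show ?thesis by simp
qed

lemma rat_poly_at_add: "rat_poly_at (p + q) x = rat_poly_at p x + rat_poly_at q x"
proof -
  have "map_poly of_rat (p + q) = (map_poly of_rat p + map_poly of_rat q :: complex poly)"
    by (intro poly_eqI) (simp add: coeff_map_poly of_rat_add)
  then show ?thesis by simp
qed

lemma rat_poly_at_smult: "rat_poly_at (Polynomial.smult c p) x = of_rat c * rat_poly_at p x"
proof -
  have "map_poly of_rat (Polynomial.smult c p) = Polynomial.smult (of_rat c) (map_poly of_rat p :: complex poly)"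
    by (intro poly_eqI) (simp add: coeff_map_poly of_rat_mult)
  then show ?thesis by simp
qed

lemma rat_poly_at_of_int: "rat_poly_at (map_poly of_int p) x = int_poly_at p x"
  by (simp add: map_poly_map_poly o_def)

lemma int_poly_at_altdef:
  assumes "Polynomial.degree p \<le> n"
  shows "int_poly_at p x = (\<Sum>i\<le>n. of_int (Polynomial.coeff p i) * x ^ i)"
proof -
  have "Polynomial.degree (map_poly of_int p :: complex poly) = Polynomial.degree p"
    by (simp add: degree_map_poly)
  then show ?thesis
    unfolding poly_altdef
    by (intro sum.mono_neutral_cong_left) (use assms in \<open>auto simp: coeff_map_poly coeff_eq_0\<close>)
qed

lemma rat_poly_at_altdef:
  assumes "Polynomial.degree p \<le> n"
  shows "rat_poly_at p x = (\<Sum>i\<le>n. of_rat (Polynomial.coeff p i) * x ^ i)"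
proof -
  have "Polynomial.degree (map_poly of_rat p :: complex poly) = Polynomial.degree p"
    by (simp add: degree_map_poly)
  then show ?thesis
    unfolding poly_altdef
    by (intro sum.mono_neutral_cong_left) (use assms in \<open>auto simp: coeff_map_poly coeff_eq_0\<close>)
qed

lemma rat_poly_clear_denominators:
  "\<exists>D p. D > 0 \<and> map_poly of_int p = Polynomial.smult (of_int D) (r :: rat poly)"
proof (induction r)
  case 0
  then show ?case by (intro exI[of _ 1] exI[of _ 0]) auto
next
  case (pCons a r)
  then obtain D p where D: "D > 0" "map_poly of_int p = Polynomial.smult (of_int D) r" by blast
  obtain n d where nd: "quotient_of a = (n, d)" by force
  then have d: "d > 0" "a = of_int n / of_int d"
    using quotient_of_denom_pos quotient_of_div by blast+
  have "map_poly of_int (pCons (n * D) (Polynomial.smult d p))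
      = pCons (of_int (n * D)) (Polynomial.smult (of_int d) (map_poly of_int p) :: rat poly)"
    by (intro poly_eqI) (auto simp: coeff_map_poly coeff_pCons split: nat.splits)
  also have "\<dots> = Polynomial.smult (of_int (D * d)) (pCons a r)"
    using d by (auto simp: D(2) field_simps)
  finally show ?case using D(1) d(1) by (intro exI[of _ "D * d"] exI) auto
qed

text \<open>
  A monic polynomial of least degree vanishing at \<open>x\<close> divides, by division with remainder, every other
  such polynomial; a factorization of it has a factor vanishing at \<open>x\<close>, so the cofactor is a unit.
\<close>
lemma rat_minpoly_exists:
  assumes "algebraic x"
  obtains r where "Factorial_Ring.irreducible r" "Polynomial.lead_coeff r = 1"
    "rat_poly_at r x = 0" "\<And>p. rat_poly_at p x = 0 \<Longrightarrow> r dvd p"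
proof -
  define P where "P = (\<lambda>p. p \<noteq> 0 \<and> rat_poly_at p x = 0)"
  obtain q where q: "q \<noteq> 0" "int_poly_at q x = 0" using assms by (rule algebraicE')
  then have "P (map_poly of_int q)"
    unfolding P_def rat_poly_at_of_int by (auto simp: map_poly_eq_0_iff)
  then obtain r0 where r0: "P r0" and min: "\<And>p. P p \<Longrightarrow> Polynomial.degree r0 \<le> Polynomial.degree p"
    using ex_has_least_nat[of P "map_poly of_int q" Polynomial.degree] by blast
  define r where "r = Polynomial.smult (inverse (Polynomial.lead_coeff r0)) r0"
  have r: "P r" "Polynomial.lead_coeff r = 1" "Polynomial.degree r = Polynomial.degree r0"
    using r0 by (auto simp: P_def r_def rat_poly_at_smult)
  have dvd: "r dvd p" if "rat_poly_at p x = 0" for p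
  proof -
    have "rat_poly_at p x = rat_poly_at (r * (p div r) + p mod r) x" by simp
    then have "rat_poly_at (p mod r) x = 0"
      using that r(1) unfolding rat_poly_at_add rat_poly_at_mult P_def by simp
    then have "p mod r = 0"
      using min[of "p mod r"] degree_mod_less[of r p] r unfolding P_def by linarith
    then show ?thesis by (simp add: dvd_eq_mod_eq_0)
  qed
  have "Factorial_Ring.irreducible r"
  proof (rule Factorial_Ring.irreducibleI)
    show "r \<noteq> 0" using r(1) by (simp add: P_def)
    show "\<not> is_unit r"
    proof
      assume "is_unit r"
      then obtain c where "r = [:c:]" by (auto simp: is_unit_poly_iff)
      then show False using r(1) by (auto simp: P_def map_poly_pCons)
    qed
  next
    fix a b assume ab: "r = a * b"
    then have nz: "a \<noteq> 0" "b \<noteq> 0" using r(1) by (auto simp: P_def)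
    have *: "is_unit b'" if "r = a' * b'" "rat_poly_at a' x = 0" for a' b'
    proof -
      have "r dvd a'" by (rule dvd) fact
      then have "a' * b' dvd a' * 1" using that by simp
      then show ?thesis using that r(1) by (auto simp: P_def dvd_times_left_cancel_iff simp del: mult_1_right)
    qed
    have "rat_poly_at a x * rat_poly_at b x = 0"
      using r(1) unfolding P_def ab rat_poly_at_mult by simp
    then show "is_unit a \<or> is_unit b"
      using *[of a b] *[of b a] ab by (auto simp: mult.commute)
  qed
  with r dvd that show thesis by (auto simp: P_def)
qed

lemma rat_minpoly_properties:
  assumes "algebraic x"
  shows "Factorial_Ring.irreducible (rat_minpoly x)" "Polynomial.lead_coeff (rat_minpoly x) = 1"
    "rat_poly_at (rat_minpoly x) x = 0" "rat_poly_at p x = 0 \<Longrightarrow> rat_minpoly x dvd p"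
proof -
  obtain r where r: "Factorial_Ring.irreducible r" "Polynomial.lead_coeff r = 1"
    "rat_poly_at r x = 0" "\<And>p. rat_poly_at p x = 0 \<Longrightarrow> r dvd p"
    using rat_minpoly_exists[OF assms] by blast
  have "rat_minpoly x = r"
    unfolding rat_minpoly_def
  proof (rule the_equality)
    show "Factorial_Ring.irreducible r \<and> Polynomial.lead_coeff r = 1 \<and> rat_poly_at r x = 0"
      using r by blast
  next
    fix q assume q: "Factorial_Ring.irreducible q \<and> Polynomial.lead_coeff q = 1 \<and> rat_poly_at q x = 0"
    then obtain u where u: "q = r * u" using r(4) by blast
    then have "is_unit u" using q r(1) by (metis Factorial_Ring.irreducibleD Factorial_Ring.irreducible_not_unit)
    then obtain c where c: "u = [:c:]" by (auto simp: is_unit_poly_iff)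
    have "Polynomial.lead_coeff q = Polynomial.lead_coeff r * Polynomial.lead_coeff u"
      unfolding u by (rule lead_coeff_mult)
    then have "c = 1" using q r(2) c by simp
    then show "q = r" using u c by simp
  qed
  with r show "Factorial_Ring.irreducible (rat_minpoly x)" "Polynomial.lead_coeff (rat_minpoly x) = 1"
    "rat_poly_at (rat_minpoly x) x = 0" "rat_poly_at p x = 0 \<Longrightarrow> rat_minpoly x dvd p"
    by auto
qed

lemma algebraic_degree_le:
  assumes "p \<noteq> 0" "rat_poly_at p x = 0"
  shows "algebraic x" "algebraic_degree x \<le> Polynomial.degree p"
proof -
  show *: "algebraic x"
    by (rule algebraicI'[of "map_poly of_rat p"]) (use assms in \<open>auto simp: coeff_map_poly map_poly_eq_0_iff\<close>)
  show "algebraic_degree x \<le> Polynomial.degree p"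
    unfolding algebraic_degree_def using rat_minpoly_properties(4)[OF * assms(2)] assms(1)
    by (rule dvd_imp_degree_le)
qed

lemma algebraic_degree_pos:
  assumes "algebraic x" shows "algebraic_degree x \<ge> 1"
proof (rule ccontr)
  assume "\<not> ?thesis"
  then obtain c where c: "rat_minpoly x = [:c:]"
    unfolding algebraic_degree_def by (metis degree_eq_zeroE less_one not_le)
  with rat_minpoly_properties(2)[OF assms] rat_minpoly_properties(3)[OF assms] show False
    by (auto simp: map_poly_pCons)
qed

text \<open>
  The same argument over \<open>\<int>\<close> needs pseudo-division, which only gives divisibility after multiplication
  by a constant. Choosing the polynomial of least degree primitive makes the constant cancel, by
  multiplicativity of the content (Gauss's lemma).
\<close>
lemma primitive_int_minpoly_exists:
  assumes "algebraic x"
  obtains g where "Factorial_Ring.irreducible g" "int_poly_at g x = 0"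
    "\<And>p. int_poly_at p x = 0 \<Longrightarrow> g dvd p"
proof -
  define P where "P = (\<lambda>p. p \<noteq> 0 \<and> int_poly_at p x = 0)"
  obtain q where q: "q \<noteq> 0" "int_poly_at q x = 0" using assms by (rule algebraicE')
  then have "P q" unfolding P_def by blast
  then obtain g0 where g0: "P g0" and min: "\<And>p. P p \<Longrightarrow> Polynomial.degree g0 \<le> Polynomial.degree p"
    using ex_has_least_nat[of P q Polynomial.degree] by blast
  define g where "g = primitive_part g0"
  have "of_int (content g0) * int_poly_at g x = 0"
    using int_poly_at_smult[of "content g0" g x] g0 by (auto simp: P_def g_def)
  then have g: "P g" "Polynomial.degree g = Polynomial.degree g0" "content g = 1"
    using g0 by (auto simp: P_def g_def)
  have dvd: "g dvd p" if "int_poly_at p x = 0" for p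
  proof -
    obtain a u where au: "a \<noteq> 0" "Polynomial.smult a p = g * u + pseudo_mod p g"
      using pseudo_mod(1)[of g p] g(1) by (auto simp: P_def)
    have "int_poly_at (g * u + pseudo_mod p g) x = 0"
      unfolding au(2)[symmetric] using that by (simp add: int_poly_at_smult)
    then have "int_poly_at (pseudo_mod p g) x = 0"
      using g(1) by (simp add: int_poly_at_add int_poly_at_mult P_def)
    then have "pseudo_mod p g = 0"
      using min[of "pseudo_mod p g"] pseudo_mod(2)[of g p] g unfolding P_def by linarith
    then have eq: "Polynomial.smult a p = g * u" using au by simp
    then have "content (Polynomial.smult a p) = content (g * u)" by simp
    then have "a dvd content u" using g(3) by (simp add: content_mult) (metis dvd_triv_left dvd_mult_left mult_commute_abs abs_dvd_iff)
    then obtain u' where "u = Polynomial.smult a u'"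
      by (metis const_poly_dvd_iff_dvd_content dvdE mult_pCons_left add_0_right pCons_0_0 mult_zero_left)
    then have "Polynomial.smult a p = Polynomial.smult a (g * u')" using eq by simp
    then have "p = g * u'" using au(1) by (simp add: smult_eq_iff poly_eq_iff)
    then show ?thesis by simp
  qed
  have "Factorial_Ring.irreducible g"
  proof (rule Factorial_Ring.irreducibleI)
    show "g \<noteq> 0" using g(1) by (simp add: P_def)
    show "\<not> is_unit g"
    proof
      assume "is_unit g"
      then obtain c where "g = [:c:]" by (auto simp: is_unit_poly_iff)
      then show False using g(1) by (auto simp: P_def map_poly_pCons)
    qed
  next
    fix a b assume ab: "g = a * b"
    then have nz: "a \<noteq> 0" "b \<noteq> 0" using g(1) by (auto simp: P_def)
    have *: "is_unit b'" if "g = a' * b'" "int_poly_at a' x = 0" for a' b'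
    proof -
      have "g dvd a'" by (rule dvd) fact
      then have "a' * b' dvd a' * 1" using that by simp
      then show ?thesis using that g(1) by (auto simp: P_def dvd_times_left_cancel_iff simp del: mult_1_right)
    qed
    have "int_poly_at a x * int_poly_at b x = 0"
      using g(1) unfolding P_def ab int_poly_at_mult by simp
    then show "is_unit a \<or> is_unit b"
      using *[of a b] *[of b a] ab by (auto simp: mult.commute)
  qed
  with g dvd that show thesis by (auto simp: P_def)
qed

text \<open>
  Consequently the minimal polynomial over \<open>\<int>\<close> is unique up to sign, and statements about it do not
  depend on which representative the choice operator selects.
\<close>
lemma irreducible_int_poly_dvd:
  assumes "Factorial_Ring.irreducible q" "int_poly_at q x = 0" "int_poly_at p x = 0"
  shows "q dvd p"
proof -
  have "q \<noteq> 0" using assms(1) by auto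
  then have "algebraic x"
    by (intro algebraicI[of "map_poly of_int q"]) (use assms(2) in \<open>auto simp: coeff_map_poly map_poly_eq_0_iff\<close>)
  then obtain g where g: "Factorial_Ring.irreducible g" "int_poly_at g x = 0"
    "\<And>p. int_poly_at p x = 0 \<Longrightarrow> g dvd p" using primitive_int_minpoly_exists by blast
  obtain u where u: "q = g * u" using g(3)[OF assms(2)] by blast
  then have "is_unit u"
    using assms(1) g(1) by (metis Factorial_Ring.irreducibleD Factorial_Ring.irreducible_not_unit)
  then show ?thesis using g(3)[OF assms(3)] u by (simp add: mult_unit_dvd_iff)
qed

lemma algebraic_iff_int_poly:
  "algebraic x \<longleftrightarrow> (\<exists>p. p \<noteq> 0 \<and> int_poly_at p x = 0)"
  by (auto elim!: algebraicE' intro!: algebraicI[of "map_poly of_int _"] simp: coeff_map_poly map_poly_eq_0_iff)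

text \<open>
  The bridge between the two minimal polynomials, obtained by clearing denominators in one direction and
  by reading an integer polynomial as a rational one in the other.
\<close>
lemma degree_irreducible_int_poly:
  assumes "Factorial_Ring.irreducible q" "int_poly_at q x = 0"
  shows "Polynomial.degree q = algebraic_degree x"
proof (rule antisym)
  have q: "q \<noteq> 0" using assms(1) by auto
  have alg: "algebraic x" using q assms(2) algebraic_iff_int_poly by blast
  obtain D p where D: "D > 0" "map_poly of_int p = Polynomial.smult (of_int D) (rat_minpoly x)"
    using rat_poly_clear_denominators by blast
  have "int_poly_at p x = 0"
    using rat_minpoly_properties(3)[OF alg]
    unfolding rat_poly_at_of_int[symmetric] D(2) rat_poly_at_smult by simp
  then have "q dvd p" using irreducible_int_poly_dvd assms by blast
  moreover have rm: "rat_minpoly x \<noteq> 0" using rat_minpoly_properties(1)[OF alg] by auto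
  have "p \<noteq> 0" using D rm by auto
  ultimately have "Polynomial.degree q \<le> Polynomial.degree p" using dvd_imp_degree_le by blast
  also have "\<dots> = Polynomial.degree (map_poly rat_of_int p)" by (simp add: degree_map_poly)
  also have "\<dots> = algebraic_degree x" using D by (simp add: algebraic_degree_def)
  finally show "Polynomial.degree q \<le> algebraic_degree x" .
  have "algebraic_degree x \<le> Polynomial.degree (map_poly rat_of_int q)"
    by (rule algebraic_degree_le) (use q assms in \<open>auto simp: rat_poly_at_of_int map_poly_eq_0_iff\<close>)
  then show "algebraic_degree x \<le> Polynomial.degree q" by (simp add: degree_map_poly)
qed

lemma int_minpoly_properties:
  assumes "algebraic x"
  shows "Factorial_Ring.irreducible (int_minpoly x)" "int_poly_at (int_minpoly x) x = 0"
    "Polynomial.degree (int_minpoly x) = algebraic_degree x"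
proof -
  have "\<exists>p. Factorial_Ring.irreducible p \<and> int_poly_at p x = 0"
    using primitive_int_minpoly_exists[OF assms] by blast
  then have *: "Factorial_Ring.irreducible (int_minpoly x) \<and> int_poly_at (int_minpoly x) x = 0"
    unfolding int_minpoly_def by (rule someI_ex)
  then show "Factorial_Ring.irreducible (int_minpoly x)" "int_poly_at (int_minpoly x) x = 0" by auto
  then show "Polynomial.degree (int_minpoly x) = algebraic_degree x"
    by (rule degree_irreducible_int_poly)
qed

lemma coeff_le_poly_height: "\<bar>Polynomial.coeff p i\<bar> \<le> poly_height p"
proof (cases "i \<le> Polynomial.degree p")
  case True
  then show ?thesis unfolding poly_height_def by (intro Max_ge) auto
next
  case False
  have "\<bar>Polynomial.coeff p 0\<bar> \<le> poly_height p"
    unfolding poly_height_def by (intro Max_ge) auto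
  then show ?thesis using False by (simp add: coeff_eq_0)
qed

lemma poly_height_le_iff: "poly_height p \<le> h \<longleftrightarrow> (\<forall>i. \<bar>Polynomial.coeff p i\<bar> \<le> h)"
proof
  assume "poly_height p \<le> h"
  then show "\<forall>i. \<bar>Polynomial.coeff p i\<bar> \<le> h" using coeff_le_poly_height order_trans by blast
next
  assume "\<forall>i. \<bar>Polynomial.coeff p i\<bar> \<le> h"
  then show "poly_height p \<le> h" unfolding poly_height_def by (intro Max.boundedI) auto
qed

lemma poly_height_ge_1: "p \<noteq> 0 \<Longrightarrow> poly_height p \<ge> 1"
  using coeff_le_poly_height[of p "Polynomial.degree p"] leading_coeff_0_iff[of p] by linarith

text \<open>
  By the degree hypothesis, the polynomial is an integer multiple of the minimal polynomial. Thus any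
  explicit annihilating polynomial of the right degree bounds the height.
\<close>
lemma int_minpoly_height_le:
  assumes "p \<noteq> 0" "int_poly_at p x = 0" "Polynomial.degree p \<le> algebraic_degree x"
  shows "poly_height (int_minpoly x) \<le> poly_height p"
proof -
  have alg: "algebraic x" using assms algebraic_iff_int_poly by blast
  note q = int_minpoly_properties[OF alg]
  obtain u where u: "p = int_minpoly x * u" using irreducible_int_poly_dvd[OF q(1,2) assms(2)] by blast
  with assms(1) have nz: "int_minpoly x \<noteq> 0" "u \<noteq> 0" by auto
  have "Polynomial.degree u = 0"
    using assms(3) q(3) degree_mult_eq[OF nz] u by simp
  then obtain c where c: "u = [:c:]" by (rule degree_eq_zeroE)
  then have "\<bar>c\<bar> \<ge> 1" using nz by auto
  have "\<bar>Polynomial.coeff (int_minpoly x) i\<bar> \<le> poly_height p" for i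
  proof -
    have "\<bar>Polynomial.coeff (int_minpoly x) i\<bar> * 1 \<le> \<bar>Polynomial.coeff (int_minpoly x) i\<bar> * \<bar>c\<bar>"
      using \<open>\<bar>c\<bar> \<ge> 1\<close> by (intro mult_left_mono) auto
    also have "\<dots> = \<bar>Polynomial.coeff p i\<bar>" by (simp add: u c abs_mult)
    also have "\<dots> \<le> poly_height p" by (rule coeff_le_poly_height)
    finally show ?thesis by simp
  qed
  then show ?thesis by (simp add: poly_height_le_iff)
qed

text \<open>
  The minimal polynomial divides a monic polynomial over \<open>\<int>\<close>, so its leading coefficient is a unit.
\<close>
lemma algebraic_int_monic_minpoly:
  assumes "algebraic_int (x :: complex)"
  obtains p where "Polynomial.lead_coeff p = 1" "int_poly_at p x = 0"
    "Polynomial.degree p = algebraic_degree x"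
proof -
  obtain f where f: "int_poly_at f x = 0" "Polynomial.lead_coeff f = 1"
    using assms by (auto simp: algebraic_int_altdef_ipoly)
  then have "f \<noteq> 0" by auto
  then have alg: "algebraic x" using f algebraic_iff_int_poly by blast
  note q = int_minpoly_properties[OF alg]
  obtain u where u: "f = int_minpoly x * u" using irreducible_int_poly_dvd[OF q(1,2) f(1)] by blast
  have "Polynomial.lead_coeff (int_minpoly x) * Polynomial.lead_coeff u = 1"
    using f(2) unfolding u lead_coeff_mult .
  then have "Polynomial.lead_coeff (int_minpoly x) dvd 1" by (metis dvd_triv_left)
  then consider "Polynomial.lead_coeff (int_minpoly x) = 1" | "Polynomial.lead_coeff (int_minpoly x) = -1"
    by (auto simp: abs_if split: if_splits)
  then show thesis
  proof cases
    case 1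
    then show thesis using that[of "int_minpoly x"] q by simp
  next
    case 2
    then show thesis using that[of "Polynomial.smult (-1) (int_minpoly x)"] q
      unfolding int_poly_at_smult by simp
  qed
qed

section \<open>Integral combinations of powers and a Liouville inequality\<close>

text \<open>
  If \<open>\<bar>x\<bar> < 1\<close> and \<open>l\<close> is the least index of a nonzero coefficient, that coefficient has absolute
  value at least 1, and \<open>\<bar>x\<bar> ^ l\<close> is bounded by the sum of the higher terms, each of which contains at
  least one more factor \<open>\<bar>x\<bar>\<close>.
\<close>
lemma nonzero_root_lower_bound:
  assumes "q \<noteq> 0" "int_poly_at q x = 0" "x \<noteq> 0" "Polynomial.degree q \<le> n" "n \<ge> 1"
  shows "norm x \<ge> 1 / (real n * real_of_int (poly_height q))"
proof (cases "norm x \<ge> 1")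
  case True
  have "real n * real_of_int (poly_height q) \<ge> 1 * 1"
    using poly_height_ge_1[OF assms(1)] assms(5) by (intro mult_mono) auto
  then have "1 / (real n * real_of_int (poly_height q)) \<le> 1" by simp
  with True show ?thesis by linarith
next
  case False
  define l where "l = (LEAST i. Polynomial.coeff q i \<noteq> 0)"
  define H where "H = real_of_int (poly_height q)"
  have H: "H \<ge> 1" using poly_height_ge_1[OF assms(1)] by (simp add: H_def)
  have "\<exists>i. Polynomial.coeff q i \<noteq> 0" using assms(1) leading_coeff_0_iff by blast
  then have l: "Polynomial.coeff q l \<noteq> 0" "\<And>i. i < l \<Longrightarrow> Polynomial.coeff q i = 0"
    unfolding l_def by (rule LeastI_ex, use not_less_Least in blast)
  then have ln: "l \<le> n" using assms(4) le_degree order_trans by blast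
  have "0 = (\<Sum>i\<le>n. of_int (Polynomial.coeff q i) * x ^ i)"
    using int_poly_at_altdef[OF assms(4), of x] assms(2) by simp
  also have "\<dots> = (\<Sum>i=l..n. of_int (Polynomial.coeff q i) * x ^ i)"
    by (rule sum.mono_neutral_right) (auto simp: l(2))
  also have "\<dots> = of_int (Polynomial.coeff q l) * x ^ l + (\<Sum>i=Suc l..n. of_int (Polynomial.coeff q i) * x ^ i)"
    by (rule sum.atLeast_Suc_atMost) (use ln in simp)
  finally have "of_int (Polynomial.coeff q l) * x ^ l = - (\<Sum>i=Suc l..n. of_int (Polynomial.coeff q i) * x ^ i)"
    by (simp add: eq_neg_iff_add_eq_0)
  then have eq: "norm (of_int (Polynomial.coeff q l) * x ^ l) = norm (\<Sum>i=Suc l..n. of_int (Polynomial.coeff q i) * x ^ i)"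
    by simp
  have "norm x ^ l * 1 \<le> norm x ^ l * \<bar>real_of_int (Polynomial.coeff q l)\<bar>"
    using l(1) by (intro mult_left_mono) auto
  also have "\<dots> = norm (of_int (Polynomial.coeff q l) * x ^ l)"
    by (simp add: norm_mult norm_power)
  also have "\<dots> \<le> (\<Sum>i=Suc l..n. H * norm x ^ Suc l)"
    unfolding eq
  proof (intro order_trans[OF norm_sum] sum_mono)
    fix i assume i: "i \<in> {Suc l..n}"
    have "\<bar>real_of_int (Polynomial.coeff q i)\<bar> \<le> H"
      using coeff_le_poly_height[of q i] unfolding H_def by linarith
    moreover have "norm x ^ i \<le> norm x ^ Suc l"
      using i False by (intro power_decreasing) auto
    ultimately show "norm (of_int (Polynomial.coeff q i) * x ^ i) \<le> H * norm x ^ Suc l"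
      by (auto simp: norm_mult norm_power intro!: mult_mono simp del: power_Suc)
  qed
  also have "\<dots> = real (n - l) * (H * norm x ^ Suc l)" by simp
  also have "\<dots> \<le> real n * (H * norm x ^ Suc l)"
    using H by (intro mult_right_mono) auto
  finally have "norm x ^ l * 1 \<le> norm x ^ l * (real n * H * norm x)"
    by (simp add: mult_ac)
  then have "1 \<le> real n * H * norm x"
    using assms(3) by (subst (asm) mult_le_cancel_left_pos) auto
  then show ?thesis using H assms(5) unfolding H_def[symmetric]
    by (simp add: divide_le_eq mult_ac)
qed

lemma int_poly_at_lipschitz:
  assumes "Polynomial.degree q \<le> k" "real_of_int (poly_height q) \<le> H" "norm x \<le> B" "norm y \<le> B" "B \<ge> 1"
  shows "norm (int_poly_at q x - int_poly_at q y) \<le> norm (x - y) * ((real k + 1) ^ 2 * H * B ^ k)"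
proof -
  have "int_poly_at q x - int_poly_at q y = (\<Sum>i\<le>k. of_int (Polynomial.coeff q i) * (x ^ i - y ^ i))"
    by (simp add: int_poly_at_altdef[OF assms(1)] sum_subtractf right_diff_distrib)
  also have "norm \<dots> \<le> (\<Sum>i\<le>k. H * (norm (x - y) * ((real k + 1) * B ^ k)))"
  proof (intro order_trans[OF norm_sum] sum_mono)
    fix i assume i: "i \<in> {..k}"
    have eq: "norm (x ^ i - y ^ i) = norm (x - y) * norm (\<Sum>j<i. y ^ (i - Suc j) * x ^ j)"
      unfolding power_diff_sumr2 norm_mult ..
    have "norm (\<Sum>j<i. y ^ (i - Suc j) * x ^ j) \<le> (\<Sum>j<i. B ^ k)"
    proof (intro order_trans[OF norm_sum] sum_mono)
      fix j assume j: "j \<in> {..<i}"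
      have "norm (y ^ (i - Suc j) * x ^ j) \<le> B ^ (i - Suc j) * B ^ j"
        using assms by (auto simp: norm_mult norm_power intro!: mult_mono power_mono)
      also have "\<dots> \<le> B ^ k"
        unfolding power_add[symmetric] using assms(5) i j by (intro power_increasing) auto
      finally show "norm (y ^ (i - Suc j) * x ^ j) \<le> B ^ k" .
    qed
    also have "(\<Sum>j<i. B ^ k) \<le> (real k + 1) * B ^ k"
      using i assms(5) by (auto intro!: mult_right_mono)
    finally have "norm (x ^ i - y ^ i) \<le> norm (x - y) * ((real k + 1) * B ^ k)"
      unfolding eq by (rule mult_left_mono) simp
    moreover have "\<bar>real_of_int (Polynomial.coeff q i)\<bar> \<le> H"
      using coeff_le_poly_height[of q i] assms(2) by linarith
    ultimately show "norm (of_int (Polynomial.coeff q i) * (x ^ i - y ^ i)) \<le> H * (norm (x - y) * ((real k + 1) * B ^ k))"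
      unfolding norm_mult by (intro mult_mono) auto
  qed
  finally show ?thesis by (simp add: algebra_simps power2_eq_square)
qed

text \<open>
  Because \<open>p\<close> is monic, the powers \<open>a ^ j\<close> with \<open>j < m\<close> generate the ring \<open>\<int>[a]\<close> as an additive
  group, and multiplication by \<open>a\<close> acts on coordinates by an integer matrix.
\<close>
locale monic_root =
  fixes a :: complex and m :: nat and p :: "int poly"
  assumes monic: "Polynomial.lead_coeff p = 1"
    and degree_p: "Polynomial.degree p = m"
    and root: "int_poly_at p a = 0"
begin

definition bounded_combs :: "real \<Rightarrow> complex set" where
  "bounded_combs E =
     {\<Sum>j<m. of_int (b j) * a ^ j | b :: nat \<Rightarrow> int. \<forall>j<m. \<bar>real_of_int (b j)\<bar> \<le> E}"

text \<open>
  Multiplication by \<open>a\<close> increases the size of the coordinates at most by this factor; the next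
  constant, \<open>mult_growth\<close>, is the price of multiplying two elements.
\<close>
definition growth :: real where
  "growth = 1 + real_of_int (poly_height p)"

definition mult_growth :: real where
  "mult_growth = (\<Sum>j<m. growth ^ j)"

lemma degree_pos: "m \<ge> 1"
proof (rule ccontr)
  assume "\<not> ?thesis"
  then obtain c where "p = [:c:]" using degree_p by (metis degree_eq_zeroE less_one not_le)
  then show False using monic root by (simp add: map_poly_pCons)
qed

lemma growth_ge_1: "growth \<ge> 1"
proof -
  have "p \<noteq> 0" using monic by auto
  then have "poly_height p \<ge> 1" by (rule poly_height_ge_1)
  then show ?thesis by (simp add: growth_def)
qed

lemma mult_growth_ge_1: "mult_growth \<ge> 1"
proof -
  have "growth ^ 0 \<le> mult_growth"
    unfolding mult_growth_def using degree_pos growth_ge_1 by (intro member_le_sum) auto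
  then show ?thesis by simp
qed

lemma bounded_combsI:
  assumes "x = (\<Sum>j<m. of_int (b j) * a ^ j)" "\<And>j. j < m \<Longrightarrow> \<bar>real_of_int (b j)\<bar> \<le> E"
  shows "x \<in> bounded_combs E"
  using assms unfolding bounded_combs_def by blast

lemma bounded_combsE:
  assumes "x \<in> bounded_combs E"
  obtains b :: "nat \<Rightarrow> int" where "x = (\<Sum>j<m. of_int (b j) * a ^ j)"
    "\<And>j. j < m \<Longrightarrow> \<bar>real_of_int (b j)\<bar> \<le> E"
  using assms unfolding bounded_combs_def by blast

lemma bounded_combs_mono: "x \<in> bounded_combs E \<Longrightarrow> E \<le> F \<Longrightarrow> x \<in> bounded_combs F"
  unfolding bounded_combs_def by fastforce

lemma bounded_combs_zero: "0 \<in> bounded_combs 0"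
  by (rule bounded_combsI[where b = "\<lambda>_. 0"]) auto

lemma bounded_combs_one: "1 \<in> bounded_combs 1"
proof (rule bounded_combsI[where b = "\<lambda>j. if j = 0 then 1 else 0"])
  have "(\<Sum>j<m. of_int (if j = 0 then 1 else 0) * a ^ j) = (\<Sum>j<m. if j = 0 then 1 else 0 :: complex)"
    by (intro sum.cong) auto
  then show "1 = (\<Sum>j<m. of_int (if j = 0 then 1 else 0) * a ^ j)"
    using degree_pos by simp
qed auto

lemma bounded_combs_add:
  assumes "x \<in> bounded_combs E" "y \<in> bounded_combs F"
  shows "x + y \<in> bounded_combs (E + F)"
proof -
  obtain b where b: "x = (\<Sum>j<m. of_int (b j) * a ^ j)" "\<And>j. j < m \<Longrightarrow> \<bar>real_of_int (b j)\<bar> \<le> E"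
    using assms(1) by (rule bounded_combsE) blast
  obtain c where c: "y = (\<Sum>j<m. of_int (c j) * a ^ j)" "\<And>j. j < m \<Longrightarrow> \<bar>real_of_int (c j)\<bar> \<le> F"
    using assms(2) by (rule bounded_combsE) blast
  show ?thesis
  proof (rule bounded_combsI[where b = "\<lambda>j. b j + c j"])
    show "x + y = (\<Sum>j<m. of_int (b j + c j) * a ^ j)"
      by (simp add: b(1) c(1) sum.distrib ring_distribs)
    show "\<bar>real_of_int (b j + c j)\<bar> \<le> E + F" if "j < m" for j
      using b(2)[OF that] c(2)[OF that] by linarith
  qed
qed

lemma bounded_combs_scale:
  assumes "x \<in> bounded_combs E" "\<bar>real_of_int n\<bar> \<le> F"
  shows "of_int n * x \<in> bounded_combs (F * E)"
proof -
  obtain b where b: "x = (\<Sum>j<m. of_int (b j) * a ^ j)" "\<And>j. j < m \<Longrightarrow> \<bar>real_of_int (b j)\<bar> \<le> E"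
    using assms(1) by (rule bounded_combsE) blast
  show ?thesis
  proof (rule bounded_combsI[where b = "\<lambda>j. n * b j"])
    show "of_int n * x = (\<Sum>j<m. of_int (n * b j) * a ^ j)"
      by (simp add: b(1) sum_distrib_left mult.assoc)
    show "\<bar>real_of_int (n * b j)\<bar> \<le> F * E" if "j < m" for j
      using b(2)[OF that] assms(2) by (auto simp: abs_mult intro!: mult_mono)
  qed
qed

lemma bounded_combs_sum:
  assumes "finite A" "\<And>i. i \<in> A \<Longrightarrow> x i \<in> bounded_combs (E i)"
  shows "(\<Sum>i\<in>A. x i) \<in> bounded_combs (\<Sum>i\<in>A. E i)"
  using assms by (induction A rule: finite_induct) (auto intro: bounded_combs_zero bounded_combs_add)

lemma top_power: "a ^ m = - (\<Sum>j<m. of_int (Polynomial.coeff p j) * a ^ j)"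
proof -
  have "0 = (\<Sum>j\<le>m. of_int (Polynomial.coeff p j) * a ^ j)"
    using int_poly_at_altdef[of p m a] degree_p root by simp
  also have "\<dots> = (\<Sum>j<m. of_int (Polynomial.coeff p j) * a ^ j) + a ^ m"
    using monic degree_p by (simp add: lessThan_Suc_atMost[symmetric])
  finally show ?thesis by (simp add: eq_neg_iff_add_eq_0 add.commute)
qed

text \<open>
  Multiplication by \<open>a\<close> shifts the coordinates; the overflow into \<open>a ^ m\<close> is rewritten with the monic
  relation.
\<close>
lemma bounded_combs_times_root:
  assumes "x \<in> bounded_combs E"
  shows "a * x \<in> bounded_combs (growth * E)"
proof -
  obtain b where b: "x = (\<Sum>j<m. of_int (b j) * a ^ j)" "\<And>j. j < m \<Longrightarrow> \<bar>real_of_int (b j)\<bar> \<le> E"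
    using assms by (rule bounded_combsE) blast
  obtain d where d: "m = Suc d" using degree_pos by (cases m) auto
  define c where "c = (\<lambda>j. if j = 0 then 0 else b (j - 1))"
  show ?thesis
  proof (rule bounded_combsI[where b = "\<lambda>j. c j - b d * Polynomial.coeff p j"])
    have "a * x = (\<Sum>j<Suc d. of_int (b j) * a ^ Suc j)"
      by (simp add: b(1) d sum_distrib_left algebra_simps)
    also have "\<dots> = (\<Sum>j<d. of_int (b j) * a ^ Suc j) + of_int (b d) * a ^ m"
      by (simp add: d)
    also have "(\<Sum>j<d. of_int (b j) * a ^ Suc j) = (\<Sum>j<m. of_int (c j) * a ^ j)"
      unfolding d sum.lessThan_Suc_shift by (simp add: c_def)
    also have "\<dots> + of_int (b d) * a ^ m = (\<Sum>j<m. of_int (c j - b d * Polynomial.coeff p j) * a ^ j)"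
      unfolding top_power
      by (simp add: sum_distrib_left left_diff_distrib sum_subtractf mult.assoc)
    finally show "a * x = (\<Sum>j<m. of_int (c j - b d * Polynomial.coeff p j) * a ^ j)" .
  next
    fix j assume j: "j < m"
    have E: "\<bar>real_of_int (b d)\<bar> \<le> E" using b(2)[of d] d by simp
    have "\<bar>real_of_int (c j)\<bar> \<le> E"
      using b(2)[of "j - 1"] j E by (auto simp: c_def)
    moreover have "\<bar>real_of_int (b d * Polynomial.coeff p j)\<bar> \<le> E * real_of_int (poly_height p)"
    proof -
      have "\<bar>real_of_int (Polynomial.coeff p j)\<bar> \<le> real_of_int (poly_height p)"
        using coeff_le_poly_height[of p j] by linarith
      then show ?thesis using E by (auto simp: abs_mult intro!: mult_mono)
    qed
    ultimately show "\<bar>real_of_int (c j - b d * Polynomial.coeff p j)\<bar> \<le> growth * E"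
      by (simp add: growth_def algebra_simps)
  qed
qed

lemma bounded_combs_times_root_power:
  "x \<in> bounded_combs E \<Longrightarrow> a ^ n * x \<in> bounded_combs (growth ^ n * E)"
  by (induction n) (auto dest: bounded_combs_times_root simp: mult.assoc)

lemma bounded_combs_mult:
  assumes "x \<in> bounded_combs E" "y \<in> bounded_combs F"
  shows "x * y \<in> bounded_combs (mult_growth * E * F)"
proof -
  obtain b where b: "x = (\<Sum>j<m. of_int (b j) * a ^ j)" "\<And>j. j < m \<Longrightarrow> \<bar>real_of_int (b j)\<bar> \<le> E"
    using assms(1) by (rule bounded_combsE) blast
  have "x * y = (\<Sum>j<m. of_int (b j) * (a ^ j * y))"
    by (simp add: b(1) sum_distrib_right mult.assoc)
  also have "\<dots> \<in> bounded_combs (\<Sum>j<m. E * (growth ^ j * F))"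
    by (intro bounded_combs_sum bounded_combs_scale bounded_combs_times_root_power assms(2) b(2)) auto
  also have "(\<Sum>j<m. E * (growth ^ j * F)) = mult_growth * E * F"
    by (simp add: mult_growth_def sum_distrib_left sum_distrib_right algebra_simps)
  finally show ?thesis .
qed

lemma bounded_combs_power:
  assumes "x \<in> bounded_combs E"
  shows "x ^ n \<in> bounded_combs ((mult_growth * E) ^ n)"
proof (induction n)
  case (Suc n)
  then show ?case using bounded_combs_mult[OF assms Suc.IH] by (simp add: mult.assoc)
qed (simp add: bounded_combs_one)

lemma bounded_combs_power_le:
  assumes "x \<in> bounded_combs E" "E \<ge> 1" "i \<le> n"
  shows "x ^ i \<in> bounded_combs ((mult_growth * E) ^ n)"
proof (rule bounded_combs_mono[OF bounded_combs_power[OF assms(1)]])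
  have "mult_growth * E \<ge> 1 * 1" using mult_growth_ge_1 assms(2) by (intro mult_mono) auto
  then show "(mult_growth * E) ^ i \<le> (mult_growth * E) ^ n" using assms(3) by (intro power_increasing) auto
qed

lemma bounded_combs_int_poly_at:
  assumes "x \<in> bounded_combs E" "E \<ge> 1" "Polynomial.degree q \<le> k" "real_of_int (poly_height q) \<le> H"
  shows "int_poly_at q x \<in> bounded_combs ((real k + 1) * H * (mult_growth * E) ^ k)"
proof -
  have "int_poly_at q x = (\<Sum>i\<le>k. of_int (Polynomial.coeff q i) * x ^ i)"
    by (rule int_poly_at_altdef) fact
  also have "\<dots> \<in> bounded_combs (\<Sum>i\<le>k. H * (mult_growth * E) ^ k)"
  proof (intro bounded_combs_sum bounded_combs_scale)
    fix i assume "i \<in> {..k}"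
    then show "x ^ i \<in> bounded_combs ((mult_growth * E) ^ k)"
      using bounded_combs_power_le assms by simp
    show "\<bar>real_of_int (Polynomial.coeff q i)\<bar> \<le> H"
      using coeff_le_poly_height[of q i] assms(4) by linarith
  qed simp
  finally show ?thesis by (simp add: algebra_simps)
qed

text \<open>
  Siegel's lemma for \<open>m\<close> equations in \<open>m + 1\<close> unknowns. Among the \<open>(N + 1) ^ (m + 1)\<close> vectors with
  entries in \<open>{0..N}\<close> two have the same image under the linear map given by \<open>c\<close>, because the images
  lie in a box with at most \<open>(D (N + 1)) ^ m\<close> points and \<open>N = D ^ m\<close>. The difference of two such
  vectors is the relation.
\<close>
lemma integer_relation_of_box:
  fixes c :: "nat \<Rightarrow> nat \<Rightarrow> int" and G :: nat
  assumes c: "\<And>i j. i \<le> m \<Longrightarrow> j < m \<Longrightarrow> \<bar>c i j\<bar> \<le> int G" and "G \<ge> 1"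
  obtains q :: "nat \<Rightarrow> int" where "\<And>j. j < m \<Longrightarrow> (\<Sum>i\<le>m. q i * c i j) = 0"
    "\<And>i. i \<le> m \<Longrightarrow> \<bar>q i\<bar> \<le> (2 * (int m + 1) * int G) ^ m" "\<exists>i\<le>m. q i \<noteq> 0"
proof -
  define D where "D = 2 * (m + 1) * G"
  define N where "N = D ^ m"
  define L where "L = (m + 1) * N * G"
  define U where "U = {..m} \<rightarrow>\<^sub>E {0..int N}"
  define V where "V = {..<m} \<rightarrow>\<^sub>E {- int L..int L}"
  define \<phi> where "\<phi> = (\<lambda>u :: nat \<Rightarrow> int. \<lambda>j\<in>{..<m}. \<Sum>i\<le>m. u i * c i j)"
  have "\<phi> ` U \<subseteq> V"
  proof
    fix v assume "v \<in> \<phi> ` U"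
    then obtain u where u: "u \<in> U" "v = \<phi> u" by blast
    have "\<bar>\<Sum>i\<le>m. u i * c i j\<bar> \<le> int L" if "j < m" for j
    proof -
      have "\<bar>\<Sum>i\<le>m. u i * c i j\<bar> \<le> (\<Sum>i\<le>m. int N * int G)"
        using c u(1) that unfolding U_def
        by (intro order_trans[OF sum_abs] sum_mono) (auto simp: abs_mult PiE_iff intro!: mult_mono)
      then show ?thesis by (simp add: L_def algebra_simps)
    qed
    then show "v \<in> V" unfolding u(2) \<phi>_def V_def by (auto simp: abs_le_iff) (metis minus_le_iff)
  qed
  moreover have "finite V" unfolding V_def by (intro finite_PiE) auto
  moreover have "card V < card U"
  proof -
    have "card V = (2 * L + 1) ^ m" unfolding V_def by (simp add: card_PiE nat_add_distrib nat_mult_distrib)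
    also have "\<dots> \<le> (D * (N + 1)) ^ m"
    proof (rule power_mono)
      have "D \<ge> 1" using \<open>G \<ge> 1\<close> by (simp add: D_def)
      moreover have "2 * L = D * N" by (simp add: L_def D_def algebra_simps)
      ultimately show "2 * L + 1 \<le> D * (N + 1)" by simp
    qed simp
    also have "\<dots> = N * (N + 1) ^ m" by (simp only: power_mult_distrib N_def)
    also have "\<dots> < (N + 1) * (N + 1) ^ m" by simp
    also have "\<dots> = card U" unfolding U_def by (simp add: card_PiE nat_add_distrib)
    finally show ?thesis .
  qed
  ultimately have "\<not> inj_on \<phi> U" using card_inj_on_le by (metis not_less)
  then obtain u v where uv: "u \<in> U" "v \<in> U" "\<phi> u = \<phi> v" "u \<noteq> v"
    unfolding inj_on_def by blast
  show thesis
  proof (rule that[of "\<lambda>i. u i - v i"])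
    show "(\<Sum>i\<le>m. (u i - v i) * c i j) = 0" if "j < m" for j
    proof -
      have "\<phi> u j = \<phi> v j" using uv by simp
      then show ?thesis using that by (simp add: \<phi>_def left_diff_distrib sum_subtractf)
    qed
    show "\<bar>u i - v i\<bar> \<le> (2 * (int m + 1) * int G) ^ m" if "i \<le> m" for i
    proof -
      have "0 \<le> u i" "u i \<le> int N" "0 \<le> v i" "v i \<le> int N"
        using uv(1,2) that by (auto simp: U_def PiE_iff)
      then have "\<bar>u i - v i\<bar> \<le> int N" by linarith
      then show ?thesis by (simp add: N_def D_def algebra_simps)
    qed
    show "\<exists>i\<le>m. u i - v i \<noteq> 0"
    proof (rule ccontr)
      assume "\<not> ?thesis"
      then have "u = v"
        using uv(1,2) unfolding U_def by (intro PiE_ext) auto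
      with uv(4) show False ..
    qed
  qed
qed

text \<open>
  The \<open>m + 1\<close> elements \<open>1, x, \<dots>, x ^ m\<close> have \<open>m\<close> integer coordinates each, so that Siegel's lemma
  yields a relation between them; it is a polynomial of degree at most \<open>m\<close> vanishing at \<open>x\<close>.
\<close>
lemma small_annihilating_poly:
  "\<exists>C\<ge>1. \<forall>E\<ge>1. \<forall>x\<in>bounded_combs E.
       \<exists>q. q \<noteq> 0 \<and> Polynomial.degree q \<le> m \<and> int_poly_at q x = 0 \<and>
           real_of_int (poly_height q) \<le> C * E ^ (m * m)"
proof -
  define C where "C = (4 * (real m + 1) * mult_growth ^ m) ^ m"
  show ?thesis
  proof (intro exI[of _ C] conjI allI ballI impI)
    have "4 * (real m + 1) * mult_growth ^ m \<ge> 1 * 1"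
      using mult_growth_ge_1 by (intro mult_mono one_le_power) auto
    then show "C \<ge> 1" unfolding C_def by (intro one_le_power) simp
  next
    fix E :: real and x assume E: "E \<ge> 1" and x: "x \<in> bounded_combs E"
    define F where "F = (mult_growth * E) ^ m"
    define G where "G = nat \<lceil>F\<rceil>"
    have "mult_growth * E \<ge> 1 * 1" using mult_growth_ge_1 E by (intro mult_mono) auto
    then have F: "F \<ge> 1" unfolding F_def by (intro one_le_power) simp
    have G: "G \<ge> 1" "real G \<le> 2 * F" "F \<le> real G"
      using F unfolding G_def by linarith+
    have "\<exists>b :: nat \<Rightarrow> int. x ^ i = (\<Sum>j<m. of_int (b j) * a ^ j) \<and> (\<forall>j<m. \<bar>real_of_int (b j)\<bar> \<le> F)"
      if "i \<le> m" for i
      using bounded_combs_power_le[OF x E that] unfolding F_def by (elim bounded_combsE) blast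
    then obtain c :: "nat \<Rightarrow> nat \<Rightarrow> int" where
      c: "\<And>i. i \<le> m \<Longrightarrow> x ^ i = (\<Sum>j<m. of_int (c i j) * a ^ j)"
        "\<And>i j. i \<le> m \<Longrightarrow> j < m \<Longrightarrow> \<bar>real_of_int (c i j)\<bar> \<le> F" by metis
    have "\<bar>c i j\<bar> \<le> int G" if "i \<le> m" "j < m" for i j
      using c(2)[OF that] G(3) by linarith
    then obtain r :: "nat \<Rightarrow> int" where r: "\<And>j. j < m \<Longrightarrow> (\<Sum>i\<le>m. r i * c i j) = 0"
      "\<And>i. i \<le> m \<Longrightarrow> \<bar>r i\<bar> \<le> (2 * (int m + 1) * int G) ^ m" "\<exists>i\<le>m. r i \<noteq> 0"
      using integer_relation_of_box[OF _ G(1)] by blast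
    define q where "q = (\<Sum>i\<le>m. Polynomial.monom (r i) i)"
    have coeff: "Polynomial.coeff q i = (if i \<le> m then r i else 0)" for i
      by (simp add: q_def Polynomial.coeff_sum)
    have deg: "Polynomial.degree q \<le> m"
      by (rule degree_le) (simp add: coeff)
    have "q \<noteq> 0" using r(3) coeff by (metis coeff_0)
    moreover have "int_poly_at q x = 0"
    proof -
      have "int_poly_at q x = (\<Sum>i\<le>m. of_int (r i) * x ^ i)"
        using int_poly_at_altdef[OF deg, of x] by (simp add: coeff)
      also have "\<dots> = (\<Sum>i\<le>m. \<Sum>j<m. of_int (r i * c i j) * a ^ j)"
        using c(1) by (intro sum.cong) (auto simp: sum_distrib_left mult.assoc)
      also have "\<dots> = (\<Sum>j<m. of_int (\<Sum>i\<le>m. r i * c i j) * a ^ j)"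
        by (subst sum.swap) (simp add: sum_distrib_right)
      also have "\<dots> = 0" using r(1) by simp
      finally show ?thesis .
    qed
    moreover have "real_of_int (poly_height q) \<le> C * E ^ (m * m)"
    proof -
      have "poly_height q \<le> (2 * (int m + 1) * int G) ^ m"
        unfolding poly_height_le_iff using r(2) by (auto simp: coeff)
      then have "real_of_int (poly_height q) \<le> real_of_int ((2 * (int m + 1) * int G) ^ m)"
        by (simp only: of_int_le_iff)
      also have "\<dots> = (2 * (real m + 1) * real G) ^ m" by simp
      also have "\<dots> \<le> (2 * (real m + 1) * (2 * F)) ^ m"
        using G by (intro power_mono mult_left_mono) auto
      also have "\<dots> = (4 * (real m + 1) * mult_growth ^ m * E ^ m) ^ m"
        unfolding F_def power_mult_distrib[of mult_growth] by (rule arg_cong[of _ _ "\<lambda>y. y ^ m"]) simp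
      also have "\<dots> = C * E ^ (m * m)"
        unfolding C_def power_mult by (rule power_mult_distrib)
      finally show ?thesis .
    qed
    ultimately show "\<exists>q. q \<noteq> 0 \<and> Polynomial.degree q \<le> m \<and> int_poly_at q x = 0 \<and>
           real_of_int (poly_height q) \<le> C * E ^ (m * m)" using deg by blast
  qed
qed

text \<open>
  In place of the norm of \<open>x\<close>, a small annihilating polynomial bounds a nonzero \<open>x\<close> from below.
\<close>
lemma bounded_combs_lower_bound:
  "\<exists>C\<ge>1. \<forall>E\<ge>1. \<forall>x\<in>bounded_combs E. x \<noteq> 0 \<longrightarrow> 1 \<le> norm x * (C * E ^ (m * m))"
proof -
  obtain C where C: "C \<ge> 1"
    "\<forall>E\<ge>1. \<forall>x\<in>bounded_combs E.
       \<exists>q. q \<noteq> 0 \<and> Polynomial.degree q \<le> m \<and> int_poly_at q x = 0 \<and>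
           real_of_int (poly_height q) \<le> C * E ^ (m * m)"
    using small_annihilating_poly by blast
  show ?thesis
  proof (intro exI[of _ "real m * C"] conjI allI ballI impI)
    have "real m * C \<ge> 1 * 1" using degree_pos C(1) by (intro mult_mono) auto
    then show "real m * C \<ge> 1" by simp
  next
    fix E :: real and x assume *: "E \<ge> 1" "x \<in> bounded_combs E" "x \<noteq> 0"
    then obtain q where q: "q \<noteq> 0" "Polynomial.degree q \<le> m" "int_poly_at q x = 0"
      "real_of_int (poly_height q) \<le> C * E ^ (m * m)" using C(2) by blast
    have h: "real_of_int (poly_height q) \<ge> 1" using poly_height_ge_1[OF q(1)] by simp
    then have "0 < real m * real_of_int (poly_height q)" using degree_pos by simp
    then have "1 \<le> norm x * (real m * real_of_int (poly_height q))"
      using nonzero_root_lower_bound[OF q(1,3) *(3) q(2) degree_pos] by (simp add: divide_le_eq)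
    also have "\<dots> \<le> norm x * (real m * (C * E ^ (m * m)))"
      using q(4) by (intro mult_left_mono) auto
    finally show "1 \<le> norm x * (real m * C * E ^ (m * m))" by (simp add: mult.assoc)
  qed
qed

text \<open>
  The value \<open>q(x)\<close> is again an element of \<open>\<int>[a]\<close> with controlled coordinates and is nonzero, so it is
  not too small; on the other hand \<open>q(x) = q(x) - q(\<delta>)\<close> is at most a multiple of \<open>\<bar>x - \<delta>\<bar>\<close>. The
  constants depend only on the degree bound \<open>k\<close> and the radius \<open>B\<close>, not on \<open>E\<close>, \<open>H\<close>, \<open>q\<close> or
  \<open>\<delta>\<close>.
\<close>
lemma liouville_inequality:
  fixes k :: nat and B :: real
  assumes "B \<ge> 1"
  shows "\<exists>C\<ge>1. \<exists>M. \<forall>E\<ge>1. \<forall>H\<ge>1. \<forall>x\<in>bounded_combs E. \<forall>q \<delta>.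
       norm x \<le> B \<and> norm \<delta> \<le> B \<and> Polynomial.degree q \<le> k \<and> real_of_int (poly_height q) \<le> H \<and>
       int_poly_at q \<delta> = 0 \<and> int_poly_at q x \<noteq> 0 \<longrightarrow> 1 \<le> norm (x - \<delta>) * (C * (H * E) ^ M)"
proof -
  obtain C where C: "C \<ge> 1"
    "\<forall>E\<ge>1. \<forall>x\<in>bounded_combs E. x \<noteq> 0 \<longrightarrow> 1 \<le> norm x * (C * E ^ (m * m))"
    using bounded_combs_lower_bound by blast
  define K where "K = (real k + 1) * mult_growth ^ k"
  define N where "N = (k + 1) * (m * m) + 1"
  define C' where "C' = (real k + 1) ^ 2 * B ^ k * C * K ^ (m * m)"
  have K: "K \<ge> 1" unfolding K_def using mult_growth_ge_1
    by (intro mult_ge1_I one_le_power) auto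
  have C': "C' \<ge> 1"
  proof -
    have "1 * 1 * 1 * 1 \<le> C'" unfolding C'_def
      using assms C(1) K by (intro mult_mono one_le_power) auto
    then show ?thesis by simp
  qed
  show ?thesis
  proof (intro exI[of _ C'] exI[of _ N] conjI allI ballI impI C')
    fix E H :: real and x \<delta> q
    assume E: "E \<ge> 1" and H: "H \<ge> 1" and x0: "x \<in> bounded_combs E"
      and "norm x \<le> B \<and> norm \<delta> \<le> B \<and> Polynomial.degree q \<le> k \<and> real_of_int (poly_height q) \<le> H \<and>
        int_poly_at q \<delta> = 0 \<and> int_poly_at q x \<noteq> 0"
    then have x: "x \<in> bounded_combs E" "norm x \<le> B" and \<delta>: "norm \<delta> \<le> B"
      and q: "Polynomial.degree q \<le> k" "real_of_int (poly_height q) \<le> H"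
        "int_poly_at q \<delta> = 0" "int_poly_at q x \<noteq> 0" by auto
    define E' where "E' = (real k + 1) * H * (mult_growth * E) ^ k"
    have E'_eq: "E' = K * (H * E ^ k)"
      by (simp add: E'_def K_def power_mult_distrib algebra_simps)
    have HE: "H * E ^ k \<ge> 1" using H E by (intro mult_ge1_I one_le_power) auto
    have HE': "H * E \<ge> 1" using H E by (intro mult_ge1_I) auto
    have E': "E' \<ge> 1" unfolding E'_eq using mult_ge1_I[OF K HE] .
    have HEle: "H * E ^ k \<le> (H * E) ^ (k + 1)"
    proof -
      have "H * E ^ k \<le> H ^ Suc k * E ^ Suc k"
        using H E power_increasing[of 1 "Suc k" H] power_increasing[of k "Suc k" E] by (intro mult_mono) auto
      then show ?thesis by (simp add: power_mult_distrib mult_ac)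
    qed
    have lip: "norm (int_poly_at q x) \<le> norm (x - \<delta>) * ((real k + 1) ^ 2 * H * B ^ k)"
      using int_poly_at_lipschitz[OF q(1,2) x(2) \<delta> assms] q(3) by simp
    have "E' ^ (m * m) \<le> (K * (H * E) ^ (k + 1)) ^ (m * m)"
      unfolding E'_eq using HEle HE K by (intro power_mono mult_left_mono) auto
    then have E'_power: "E' ^ (m * m) \<le> K ^ (m * m) * (H * E) ^ ((k + 1) * (m * m))"
      by (simp only: power_mult_distrib power_mult)
    have "1 \<le> norm (int_poly_at q x) * (C * E' ^ (m * m))"
      using C(2) E' q(4) bounded_combs_int_poly_at[OF x(1) E q(1,2), folded E'_def] by blast
    also have "\<dots> \<le> norm (x - \<delta>) * ((real k + 1) ^ 2 * H * B ^ k) *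
        (C * (K ^ (m * m) * (H * E) ^ ((k + 1) * (m * m))))"
      using lip E'_power C(1) E' H assms by (intro mult_mono mult_left_mono mult_nonneg_nonneg) auto
    also have "\<dots> = norm (x - \<delta>) * (C' * ((H * E) ^ ((k + 1) * (m * m)) * H))"
      by (simp add: C'_def algebra_simps)
    also have "\<dots> \<le> norm (x - \<delta>) * (C' * ((H * E) ^ ((k + 1) * (m * m)) * (H * E)))"
      using C' H E HE' by (intro mult_left_mono) auto
    also have "\<dots> = norm (x - \<delta>) * (C' * (H * E) ^ N)"
      by (simp add: N_def mult_ac)
    finally show "1 \<le> norm (x - \<delta>) * (C' * (H * E) ^ N)" .
  qed
qed

end

section \<open>Degrees of elements of a simple number field\<close>

lemma rat_poly_at_pCons: "rat_poly_at (pCons a r) x = of_rat a + x * rat_poly_at r x"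
proof -
  have "map_poly of_rat (pCons a r) = (pCons (of_rat a) (map_poly of_rat r) :: complex poly)"
    by (intro poly_eqI) (auto simp: coeff_map_poly coeff_pCons split: nat.splits)
  then show ?thesis by simp
qed

lemma rat_poly_at_pcompose: "rat_poly_at (pcompose r q) x = rat_poly_at r (rat_poly_at q x)"
  by (induction r) (auto simp: pcompose_pCons rat_poly_at_add rat_poly_at_mult rat_poly_at_pCons)

lemma rat_poly_at_power: "rat_poly_at (q ^ n) x = rat_poly_at q x ^ n"
  by (induction n) (auto simp: rat_poly_at_mult)

text \<open>
  The \<open>n + 1\<close> powers of \<open>x\<close> lie in a rational vector space spanned by \<open>n\<close> elements, hence are
  linearly dependent, or two of them coincide. This count shows that polynomial
  expressions in an algebraic number are algebraic, and it compares their degrees.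
\<close>
lemma rat_relation_of_spanned_powers:
  fixes x :: complex and g :: "nat \<Rightarrow> complex"
  assumes "\<And>i. i \<le> n \<Longrightarrow> \<exists>c :: nat \<Rightarrow> rat. x ^ i = (\<Sum>j<n. of_rat (c j) * g j)"
  shows "\<exists>p. p \<noteq> 0 \<and> Polynomial.degree p \<le> n \<and> rat_poly_at p x = 0"
proof -
  interpret rat_space: vector_space "\<lambda>(q::rat) (z::complex). of_rat q * z"
    by unfold_locales (auto simp: algebra_simps of_rat_add of_rat_mult)
  define G where "G = g ` {..<n}"
  define S where "S = (\<lambda>i. x ^ i) ` {..n}"
  have "x ^ i \<in> rat_space.span G" if i: "i \<le> n" for i
  proof -
    obtain c :: "nat \<Rightarrow> rat" where "x ^ i = (\<Sum>j<n. of_rat (c j) * g j)" using assms[OF i] by blast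
    also have "\<dots> \<in> rat_space.span G"
      by (intro rat_space.span_sum rat_space.span_scale rat_space.span_base) (auto simp: G_def)
    finally show ?thesis .
  qed
  then have sub: "S \<subseteq> rat_space.span G" by (auto simp: S_def)
  have G: "finite G" "card G \<le> n" using card_image_le[of "{..<n}" g] by (auto simp: G_def)
  show ?thesis
  proof (cases "inj_on (\<lambda>i. x ^ i) {..n}")
    case True
    have "card S = n + 1" "finite S" using True by (auto simp: S_def card_image)
    then have "rat_space.dependent S"
      using rat_space.independent_span_bound[OF G(1) _ sub] G(2) by auto
    then obtain u where u: "\<exists>v\<in>S. u v \<noteq> 0" "(\<Sum>v\<in>S. of_rat (u v) * v) = 0"
      using rat_space.dependent_finite[OF \<open>finite S\<close>] by auto
    define p where "p = (\<Sum>i\<le>n. Polynomial.monom (u (x ^ i)) i)"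
    have coeff: "Polynomial.coeff p i = (if i \<le> n then u (x ^ i) else 0)" for i
      by (simp add: p_def Polynomial.coeff_sum)
    have deg: "Polynomial.degree p \<le> n" by (rule degree_le) (simp add: coeff)
    have "p \<noteq> 0" using u(1) coeff unfolding S_def by (metis atMost_iff coeff_0 imageE)
    moreover have "rat_poly_at p x = 0"
      using u(2) unfolding rat_poly_at_altdef[OF deg] S_def sum.reindex[OF True] by (simp add: coeff)
    ultimately show ?thesis using deg by blast
  next
    case False
    then obtain i j where "i < j" "j \<le> n" "x ^ i = x ^ j"
      unfolding inj_on_def by (metis atMost_iff linorder_neqE_nat)
    define p :: "rat poly" where "p = Polynomial.monom 1 j - Polynomial.monom 1 i"
    have coeff: "Polynomial.coeff p l = (if l = j then 1 else 0) - (if l = i then 1 else 0)" for l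
      by (auto simp: p_def)
    have deg: "Polynomial.degree p \<le> n"
      by (rule degree_le) (use \<open>i < j\<close> \<open>j \<le> n\<close> in \<open>auto simp: coeff\<close>)
    have "Polynomial.coeff p j \<noteq> 0" using \<open>i < j\<close> by (simp add: coeff)
    then have "p \<noteq> 0" by auto
    moreover have "rat_poly_at p x = 0"
    proof -
      have "map_poly of_rat p = (Polynomial.monom 1 j - Polynomial.monom 1 i :: complex poly)"
        by (intro poly_eqI) (auto simp: coeff_map_poly coeff)
      then show ?thesis using \<open>x ^ i = x ^ j\<close> by (simp add: poly_monom)
    qed
    ultimately show ?thesis using deg by blast
  qed
qed

lemma rat_poly_at_reduce:
  assumes "algebraic x"
  shows "\<exists>c :: nat \<Rightarrow> rat. rat_poly_at q x = (\<Sum>j<algebraic_degree x. of_rat (c j) * x ^ j)"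
proof -
  note r = rat_minpoly_properties[OF assms]
  define s where "s = q mod rat_minpoly x"
  have "rat_poly_at q x = rat_poly_at (rat_minpoly x * (q div rat_minpoly x) + s) x"
    by (simp add: s_def)
  also have "\<dots> = rat_poly_at s x"
    unfolding rat_poly_at_add rat_poly_at_mult r(3) by simp
  also have "\<dots> = (\<Sum>j<algebraic_degree x. of_rat (Polynomial.coeff s j) * x ^ j)"
  proof -
    obtain d where d: "algebraic_degree x = Suc d" using algebraic_degree_pos[OF assms] by (cases "algebraic_degree x") auto
    have "rat_minpoly x \<noteq> 0" using r(1) by auto
    then have "Polynomial.degree s \<le> d"
      using degree_mod_less[of "rat_minpoly x" q] d unfolding algebraic_degree_def s_def by auto
    then show ?thesis using rat_poly_at_altdef d by (simp add: lessThan_Suc_atMost)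
  qed
  finally show ?thesis by blast
qed

lemma rat_poly_at_algebraic_degree_le:
  assumes "algebraic x"
  shows "algebraic (rat_poly_at q x)" "algebraic_degree (rat_poly_at q x) \<le> algebraic_degree x"
proof -
  have "\<exists>p. p \<noteq> 0 \<and> Polynomial.degree p \<le> algebraic_degree x \<and> rat_poly_at p (rat_poly_at q x) = 0"
    by (rule rat_relation_of_spanned_powers[where g = "\<lambda>j. x ^ j"])
      (use rat_poly_at_reduce[OF assms] in \<open>simp flip: rat_poly_at_power\<close>)
  then show "algebraic (rat_poly_at q x)" "algebraic_degree (rat_poly_at q x) \<le> algebraic_degree x"
    using algebraic_degree_le le_trans by blast+
qed

text \<open>
  The constant coefficient \<open>c\<close> of the minimal polynomial \<open>c + X s(X)\<close> of a nonzero \<open>x\<close> does not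
  vanish, and \<open>x (- s(x) / c) = 1\<close>.
\<close>
lemma inverse_as_rat_poly:
  assumes "algebraic x" "x \<noteq> 0"
  shows "\<exists>r. inverse x = rat_poly_at r x"
proof -
  note r = rat_minpoly_properties[OF assms(1)]
  obtain c s where cs: "rat_minpoly x = pCons c s" by (rule pCons_cases)
  have eq: "of_rat c + x * rat_poly_at s x = 0" using r(3) unfolding cs rat_poly_at_pCons .
  have s: "s \<noteq> 0"
  proof
    assume "s = 0"
    then show False using algebraic_degree_pos[OF assms(1)] cs by (simp add: algebraic_degree_def)
  qed
  have "c \<noteq> 0"
  proof
    assume "c = 0"
    then have "rat_poly_at s x = 0" using eq assms(2) by simp
    then have "algebraic_degree x \<le> Polynomial.degree s" using algebraic_degree_le s by blast
    then show False using s unfolding algebraic_degree_def cs by simp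
  qed
  have "inverse x = rat_poly_at (Polynomial.smult (- inverse c) s) x"
  proof -
    have "x * rat_poly_at s x = - of_rat c" using eq by (simp add: eq_neg_iff_add_eq_0 add.commute)
    then have "x * (- inverse (of_rat c) * rat_poly_at s x) = 1" using \<open>c \<noteq> 0\<close>
      by (simp add: mult.left_commute[of x])
    then show ?thesis
      unfolding rat_poly_at_smult of_rat_minus of_rat_inverse by (rule inverse_unique)
  qed
  then show ?thesis by blast
qed

lemma complex_field_simps:
  "carrier complex_field = UNIV" "monoid.mult complex_field = (*)" "one complex_field = 1"
  "ring.zero complex_field = 0" "ring.add complex_field = (+)"
  by (auto simp: ring_of_type_algebra_def)

lemmas complex_field_is_ring = ring_from_type_algebra[where 'a = complex]
lemmas complex_field_is_cring = cring_from_type_algebra[where 'a = complex]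
lemmas complex_field_is_field = field_from_type_algebra[where 'a = complex]

lemma complex_field_a_inv: "a_inv complex_field x = - x"
  using abelian_group.minus_equality[OF ring.axioms(1)[OF complex_field_is_ring], of "- x" x] by (simp add: complex_field_simps)

lemma complex_field_m_inv: "x \<noteq> 0 \<Longrightarrow> m_inv complex_field x = inverse x"
  using comm_monoid.comm_inv_char[OF cring.axioms(2)[OF complex_field_is_cring], of x "inverse x"] by (simp add: complex_field_simps)

text \<open>
  The values of rational polynomials at \<open>x\<close> form the field \<open>\<rat>(x)\<close>. In this form membership immediately
  provides a polynomial expression, which is how the degree comparison below uses it.
\<close>
lemma subfield_rat_poly_range:
  assumes "algebraic x"
  shows "subfield (range (\<lambda>q. rat_poly_at q x)) complex_field"
proof (rule field.subfieldI'[OF complex_field_is_field])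
  show "subring (range (\<lambda>q. rat_poly_at q x)) complex_field"
  proof (rule ring.subringI[OF complex_field_is_ring])
    show "one complex_field \<in> range (\<lambda>q. rat_poly_at q x)"
      by (auto simp: complex_field_simps intro!: image_eqI[of _ _ 1])
  next
    fix h assume "h \<in> range (\<lambda>q. rat_poly_at q x)"
    then obtain q where "h = rat_poly_at q x" by blast
    then have "- h = rat_poly_at (Polynomial.smult (-1) q) x" unfolding rat_poly_at_smult by simp
    then show "a_inv complex_field h \<in> range (\<lambda>q. rat_poly_at q x)" by (auto simp: complex_field_a_inv)
  next
    fix h1 h2 assume "h1 \<in> range (\<lambda>q. rat_poly_at q x)" "h2 \<in> range (\<lambda>q. rat_poly_at q x)"
    then obtain q1 q2 where q: "h1 = rat_poly_at q1 x" "h2 = rat_poly_at q2 x" by blast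
    show "monoid.mult complex_field h1 h2 \<in> range (\<lambda>q. rat_poly_at q x)"
      unfolding q complex_field_simps rat_poly_at_mult[symmetric] by blast
    show "ring.add complex_field h1 h2 \<in> range (\<lambda>q. rat_poly_at q x)"
      unfolding q complex_field_simps rat_poly_at_add[symmetric] by blast
  qed (simp add: complex_field_simps)
next
  fix y assume "y \<in> range (\<lambda>q. rat_poly_at q x) - {ring.zero complex_field}"
  then obtain q where q: "y = rat_poly_at q x" "y \<noteq> 0" by (auto simp: complex_field_simps)
  then have "algebraic y" using rat_poly_at_algebraic_degree_le(1)[OF assms] by simp
  then obtain r where "inverse y = rat_poly_at r y" using inverse_as_rat_poly q(2) by blast
  then have "inverse y = rat_poly_at (pcompose r q) x" by (simp add: rat_poly_at_pcompose q(1))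
  then show "m_inv complex_field y \<in> range (\<lambda>q. rat_poly_at q x)"
    using complex_field_m_inv[OF q(2)] by simp
qed

lemma rat_adjoin_add: "x \<in> rat_adjoin \<alpha> \<Longrightarrow> y \<in> rat_adjoin \<alpha> \<Longrightarrow> x + y \<in> rat_adjoin \<alpha>"
  using generate_field.eng_add[of x complex_field "{\<alpha>}" y] by (simp add: complex_field_simps)

lemma rat_adjoin_mult: "x \<in> rat_adjoin \<alpha> \<Longrightarrow> y \<in> rat_adjoin \<alpha> \<Longrightarrow> x * y \<in> rat_adjoin \<alpha>"
  using generate_field.eng_mult[of x complex_field "{\<alpha>}" y] by (simp add: complex_field_simps)

lemma of_rat_in_rat_adjoin: "of_rat r \<in> rat_adjoin \<alpha>"
proof -
  have one: "1 \<in> rat_adjoin \<alpha>"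
    using generate_field.one[of complex_field "{\<alpha>}"] by (simp add: complex_field_simps)
  have minus: "- x \<in> rat_adjoin \<alpha>" if "x \<in> rat_adjoin \<alpha>" for x
    using generate_field.a_inv[OF that] by (simp add: complex_field_a_inv)
  have zero: "0 \<in> rat_adjoin \<alpha>"
    using rat_adjoin_add[OF one minus[OF one]] by simp
  have nat: "of_nat n \<in> rat_adjoin \<alpha>" for n
    by (induction n) (auto intro: zero one rat_adjoin_add)
  have int: "of_int n \<in> rat_adjoin \<alpha>" for n
    by (cases n rule: int_cases2) (auto intro: nat minus)
  obtain n d where nd: "quotient_of r = (n, d)" by force
  then have d: "d > 0" "r = of_int n / of_int d"
    using quotient_of_denom_pos quotient_of_div by blast+
  have "inverse (of_int d) \<in> rat_adjoin \<alpha>"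
    using generate_field.m_inv[OF int[of d]] d(1) by (simp add: complex_field_simps complex_field_m_inv)
  then have "of_int n * inverse (of_int d) \<in> rat_adjoin \<alpha>" by (intro rat_adjoin_mult int)
  then show ?thesis by (simp add: d(2) of_rat_mult of_rat_inverse divide_inverse)
qed

lemma rat_poly_at_in_rat_adjoin: "rat_poly_at q \<alpha> \<in> rat_adjoin \<alpha>"
proof (induction q)
  case 0
  show ?case using of_rat_in_rat_adjoin[of 0 \<alpha>] by simp
next
  case (pCons c q)
  then show ?case unfolding rat_poly_at_pCons
    by (intro rat_adjoin_add rat_adjoin_mult of_rat_in_rat_adjoin pCons.IH generate_field.incl singletonI)
qed

text \<open>
  By simplicity, \<open>\<rat>(x)\<close> is all of \<open>\<rat>(\<alpha>)\<close>. So each of \<open>x\<close> and \<open>\<alpha>\<close> is a polynomial expression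
  in the other, and neither degree exceeds the other.
\<close>
lemma simple_algebraic_degree:
  assumes "simple_algebraic \<alpha>" "x = rat_poly_at q \<alpha>" "x \<notin> \<rat>"
  shows "algebraic_degree x = algebraic_degree \<alpha>"
proof (rule antisym)
  have alg: "algebraic \<alpha>" using assms(1) by (simp add: simple_algebraic_def)
  then have x: "algebraic x" "algebraic_degree x \<le> algebraic_degree \<alpha>"
    using rat_poly_at_algebraic_degree_le assms(2) by auto
  then show "algebraic_degree x \<le> algebraic_degree \<alpha>" by simp
  define K where "K = range (\<lambda>r. rat_poly_at r x)"
  have const: "of_rat r \<in> K" for r
    unfolding K_def by (rule image_eqI[of _ _ "[:r:]"]) (auto simp: map_poly_pCons)
  have "rat_poly_at [:0, 1:] x = x" by (simp add: rat_poly_at_pCons)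
  then have "x \<in> K" unfolding K_def by (metis rangeI)
  have "\<rat> \<subseteq> K" using const by (auto elim: Rats_cases)
  moreover have "K \<subseteq> rat_adjoin \<alpha>"
    unfolding K_def assms(2) rat_poly_at_pcompose[symmetric] using rat_poly_at_in_rat_adjoin by blast
  moreover have "subfield K complex_field" unfolding K_def by (rule subfield_rat_poly_range[OF x(1)])
  ultimately have "K = \<rat> \<or> K = rat_adjoin \<alpha>"
    using assms(1) unfolding simple_algebraic_def by blast
  then have "\<alpha> \<in> K" using \<open>x \<in> K\<close> assms(3) generate_field.incl[of \<alpha> "{\<alpha>}" complex_field] by auto
  then show "algebraic_degree \<alpha> \<le> algebraic_degree x"
    unfolding K_def using rat_poly_at_algebraic_degree_le(2)[OF x(1)] by auto
qed

context monic_root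
begin

lemma bounded_combs_as_rat_poly:
  assumes "x \<in> bounded_combs E"
  shows "\<exists>q. x = rat_poly_at q a"
proof -
  obtain b :: "nat \<Rightarrow> int" where b: "x = (\<Sum>j<m. of_int (b j) * a ^ j)"
    using assms by (rule bounded_combsE) blast
  define q :: "rat poly" where "q = (\<Sum>j<m. Polynomial.monom (of_int (b j)) j)"
  have coeff: "Polynomial.coeff q i = (if i < m then of_int (b i) else 0)" for i
    by (simp add: q_def Polynomial.coeff_sum)
  have deg: "Polynomial.degree q \<le> m" by (rule degree_le) (simp add: coeff)
  have "rat_poly_at q a = (\<Sum>i\<le>m. of_rat (Polynomial.coeff q i) * a ^ i)"
    by (rule rat_poly_at_altdef[OF deg])
  also have "\<dots> = x" unfolding b by (simp add: coeff lessThan_Suc_atMost[symmetric])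
  finally show ?thesis by metis
qed

text \<open>
  When \<open>m\<close> is the exact degree of \<open>a\<close>, the powers \<open>a ^ j\<close> with \<open>j < m\<close> are linearly independent
  over \<open>\<rat>\<close>, so a rational combination equals its constant coordinate.
\<close>
lemma rational_bounded_combs_is_int:
  assumes "algebraic_degree a = m" "x \<in> bounded_combs E" "x \<in> \<rat>"
  shows "x \<in> \<int>"
proof -
  obtain b :: "nat \<Rightarrow> int" where b: "x = (\<Sum>j<m. of_int (b j) * a ^ j)"
    using assms(2) by (rule bounded_combsE) blast
  obtain r where r: "x = of_rat r" using assms(3) by (rule Rats_cases)
  obtain d where d: "m = Suc d" using degree_pos by (cases m) auto
  define q :: "rat poly" where "q = (\<Sum>j\<le>d. Polynomial.monom (of_int (b j)) j) - [:r:]"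
  have coeff: "Polynomial.coeff q i = (if i \<le> d then of_int (b i) else 0) - (if i = 0 then r else 0)" for i
    by (simp add: q_def Polynomial.coeff_sum coeff_pCons split: nat.splits)
  have deg: "Polynomial.degree q \<le> d" by (rule degree_le) (simp add: coeff)
  have "rat_poly_at q a = (\<Sum>i\<le>d. of_rat (Polynomial.coeff q i) * a ^ i)"
    by (rule rat_poly_at_altdef[OF deg])
  also have "\<dots> = (\<Sum>i\<le>d. of_int (b i) * a ^ i - (if i = 0 then of_rat r else 0))"
    by (intro sum.cong) (auto simp: coeff of_rat_diff algebra_simps)
  also have "\<dots> = x - of_rat r"
    unfolding sum_subtractf b d by (simp add: lessThan_Suc_atMost)
  finally have "rat_poly_at q a = 0" using r by simp
  then have "q = 0" using algebraic_degree_le(2)[of q a] deg assms(1) d by auto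
  then have "Polynomial.coeff q 0 = 0" by simp
  then have "r = of_int (b 0)" by (simp add: coeff)
  then show ?thesis using r by simp
qed

end

section \<open>Finiteness at bounded height\<close>

lemma finite_int_polys_bounded: "finite {q :: int poly. Polynomial.degree q \<le> k \<and> poly_height q \<le> h}"
proof (rule finite_subset)
  show "{q :: int poly. Polynomial.degree q \<le> k \<and> poly_height q \<le> h} \<subseteq>
      (\<lambda>u. \<Sum>i\<le>k. Polynomial.monom (u i) i) ` ({..k} \<rightarrow>\<^sub>E {-h..h})"
  proof
    fix q :: "int poly" assume "q \<in> {q. Polynomial.degree q \<le> k \<and> poly_height q \<le> h}"
    then have q: "Polynomial.degree q \<le> k" "poly_height q \<le> h" by auto
    have "q = (\<Sum>i\<le>k. Polynomial.monom (restrict (Polynomial.coeff q) {..k} i) i)"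
      using poly_as_sum_of_monoms'[OF q(1)] by simp
    moreover have "restrict (Polynomial.coeff q) {..k} \<in> {..k} \<rightarrow>\<^sub>E {-h..h}"
      using q(2) unfolding poly_height_le_iff by (auto simp: abs_le_iff) (metis minus_le_iff)
    ultimately show "q \<in> (\<lambda>u. \<Sum>i\<le>k. Polynomial.monom (u i) i) ` ({..k} \<rightarrow>\<^sub>E {-h..h})" by blast
  qed
qed (intro finite_imageI finite_PiE, auto)

lemma finite_algebraic_bounded_height:
  "finite {x :: complex. algebraic x \<and> algebraic_degree x \<le> k \<and> real_of_int (poly_height (int_minpoly x)) \<le> H}"
proof (rule finite_subset)
  let ?Q = "{q :: int poly. Polynomial.degree q \<le> k \<and> poly_height q \<le> \<lfloor>H\<rfloor>} - {0}"
  show "{x. algebraic x \<and> algebraic_degree x \<le> k \<and> real_of_int (poly_height (int_minpoly x)) \<le> H}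
      \<subseteq> (\<Union>q\<in>?Q. {x. int_poly_at q x = 0})"
  proof safe
    fix x assume x: "algebraic x" "algebraic_degree x \<le> k" "real_of_int (poly_height (int_minpoly x)) \<le> H"
    note p = int_minpoly_properties[OF x(1)]
    have "int_minpoly x \<in> ?Q" using p x by (auto simp: le_floor_iff)
    then show "x \<in> (\<Union>q\<in>?Q. {x. int_poly_at q x = 0})" using p by blast
  qed
  have "finite {x. int_poly_at q x = 0}" if "q \<noteq> 0" for q
    by (rule poly_roots_finite) (use that in \<open>simp add: map_poly_eq_0_iff\<close>)
  then show "finite (\<Union>q\<in>?Q. {x. int_poly_at q x = 0})"
    using finite_int_polys_bounded by (intro finite_UN_I) auto
qed

lemma finite_near_ints: "finite {x :: complex. x \<in> \<int> \<and> norm (z - x) \<le> r}"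
proof (rule finite_subset)
  define b where "b = \<lceil>norm z + r\<rceil>"
  show "{x. x \<in> \<int> \<and> norm (z - x) \<le> r} \<subseteq> of_int ` {- b..b}"
  proof safe
    fix x :: complex assume "x \<in> \<int>" and le: "norm (z - x) \<le> r"
    then obtain n where n: "x = of_int n" by (auto elim: Ints_cases)
    have "norm x \<le> norm z + norm (z - x)" by norm
    then have "\<bar>real_of_int n\<bar> \<le> norm z + r" using le by (simp add: n)
    then have "\<bar>n\<bar> \<le> b" unfolding b_def by linarith
    then show "x \<in> of_int ` {- b..b}" using n by (intro image_eqI[of _ _ n]) auto
  qed
qed simp

section \<open>Limits of rapidly converging sequences in an order\<close>

lemma exists_close_power_of_two:
  fixes H :: real
  assumes "H \<ge> 1"
  obtains j :: nat where "H \<le> 2 ^ j" "2 ^ j \<le> 2 * H"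
proof -
  have ex: "\<exists>j. H < 2 ^ j" by (rule real_arch_pow) simp
  define j where "j = (LEAST j. H \<le> 2 ^ j)"
  have 1: "H \<le> 2 ^ j" unfolding j_def by (rule LeastI_ex) (use ex less_imp_le in blast)
  have "2 ^ j \<le> 2 * H"
  proof (cases j)
    case (Suc i)
    then have "\<not> H \<le> 2 ^ i" using not_less_Least[of i "\<lambda>j. H \<le> 2 ^ j"] j_def by simp
    then show ?thesis using Suc by simp
  qed (use assms in simp)
  with 1 that show thesis by blast
qed

text \<open>
  The following locale collects what the series contributes: approximants \<open>\<beta> n\<close> in \<open>\<int>[a]\<close> whose
  coordinates are exponential in \<open>s n\<close> and whose error is exponentially small in \<open>t n\<close>, with the gap
  condition linking \<open>s\<close> and \<open>t\<close>. Distinctness of infinitely many consecutive approximants replaces the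
  condition that infinitely many blocks do not vanish.
\<close>
locale liouville_approximation = monic_root +
  fixes \<beta> :: "nat \<Rightarrow> complex" and s t :: "nat \<Rightarrow> nat" and \<gamma> :: complex
    and \<rho> C\<^sub>0 L :: real and R :: nat
  assumes degree_root: "algebraic_degree a = m"
    and simple_root: "simple_algebraic a"
    and gaps: "\<And>n. n \<ge> 1 \<Longrightarrow> t (n - 1) \<le> s n \<and> s n < t n"
    and gap_ratio: "filterlim (\<lambda>n. real (t n) / real (s n)) at_top sequentially"
    and block_ratio: "\<And>n. n \<ge> 1 \<Longrightarrow> s (Suc n) \<le> R * t n"
    and \<rho>: "0 < \<rho>" "\<rho> < 1"
    and C\<^sub>0: "C\<^sub>0 \<ge> 1"
    and L: "L \<ge> 1"
    and error: "\<And>n. n \<ge> 1 \<Longrightarrow> norm (\<gamma> - \<beta> n) \<le> C\<^sub>0 * \<rho> ^ t n"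
    and coords: "\<And>n. \<beta> n \<in> bounded_combs (L ^ (s n + 1))"
    and not_eventually_const: "infinite {n. \<beta> (Suc n) \<noteq> \<beta> n}"
begin

lemma t_ge: "t n \<ge> n"
proof (induction n)
  case (Suc n)
  then show ?case using gaps[of "Suc n"] by simp
qed simp

text \<open>
  Since \<open>t n\<close> eventually exceeds every multiple of \<open>s n + 1\<close>, a geometric decay in \<open>t n\<close> beats any
  geometric growth in \<open>s n\<close>. The base \<open>\<sigma>\<close> is independent of \<open>\<rho>\<close> because part of the decay is needed
  elsewhere in the estimate for smaller degrees.
\<close>
lemma gap_dominates:
  assumes "0 < \<sigma>" "\<sigma> < 1" "y \<ge> 1"
  shows "eventually (\<lambda>n. C\<^sub>0 * \<sigma> ^ t n * y ^ (s n + 1) < 1) sequentially"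
proof -
  obtain K where K: "\<sigma> ^ K < 1 / (C\<^sub>0 * y)"
    using real_arch_pow_inv[of "1 / (C\<^sub>0 * y)" \<sigma>] assms C\<^sub>0 by auto
  have "eventually (\<lambda>n. real (t n) / real (s n) \<ge> real (2 * K)) sequentially"
    using gap_ratio by (simp add: filterlim_at_top)
  moreover have "eventually (\<lambda>n. n \<ge> 2) sequentially" by (rule eventually_ge_at_top)
  ultimately show ?thesis
  proof eventually_elim
    case (elim n)
    have "s n \<ge> 1" using gaps[of n] t_ge[of "n - 1"] elim(2) by linarith
    then have "real (2 * K) * real (s n) \<le> real (t n)" using elim(1) by (simp add: le_divide_eq)
    then have "2 * K * s n \<le> t n" by (simp only: of_nat_mult[symmetric] of_nat_le_iff)
    moreover have "K * (s n + 1) \<le> 2 * K * s n" using \<open>s n \<ge> 1\<close> by (cases "s n") auto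
    ultimately have le: "K * (s n + 1) \<le> t n" by linarith
    have "\<sigma> ^ t n \<le> \<sigma> ^ (K * (s n + 1))"
      using assms by (intro power_decreasing[OF le]) auto
    then have "C\<^sub>0 * \<sigma> ^ t n * y ^ (s n + 1) \<le> C\<^sub>0 ^ (s n + 1) * \<sigma> ^ (K * (s n + 1)) * y ^ (s n + 1)"
      using C\<^sub>0 assms self_le_power[of C\<^sub>0 "s n + 1"] by (intro mult_mono) auto
    also have "\<dots> = (C\<^sub>0 * \<sigma> ^ K * y) ^ (s n + 1)" by (simp only: power_mult power_mult_distrib)
    also have "\<dots> < 1"
    proof -
      have "C\<^sub>0 * \<sigma> ^ K * y < 1" using K C\<^sub>0 assms by (simp add: field_simps)
      moreover have "0 \<le> C\<^sub>0 * \<sigma> ^ K * y" using C\<^sub>0 assms by simp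
      ultimately show ?thesis using power_less_one_iff[of "C\<^sub>0 * \<sigma> ^ K * y" "s n + 1"] by simp
    qed
    finally show ?case .
  qed
qed

lemma error_dominated:
  assumes "y \<ge> 1"
  shows "eventually (\<lambda>n. norm (\<gamma> - \<beta> n) * y ^ (s n + 1) < 1) sequentially"
  using gap_dominates[OF \<rho> assms] eventually_ge_at_top[of 1]
proof eventually_elim
  case (elim n)
  have "norm (\<gamma> - \<beta> n) * y ^ (s n + 1) \<le> C\<^sub>0 * \<rho> ^ t n * y ^ (s n + 1)"
    using error[of n] elim(2) assms by (intro mult_right_mono) auto
  with elim(1) show ?case by linarith
qed

lemma error_tendsto_zero:
  assumes "e > 0"
  shows "eventually (\<lambda>n. norm (\<gamma> - \<beta> n) < e) sequentially"
proof -
  define y where "y = max 1 (1 / e)"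
  have y: "y \<ge> 1" by (simp add: y_def)
  from error_dominated[OF y] show ?thesis
  proof eventually_elim
    case (elim n)
    have "norm (\<gamma> - \<beta> n) * (1 / e) \<le> norm (\<gamma> - \<beta> n) * y ^ (s n + 1)"
    proof (intro mult_left_mono)
      have "1 / e \<le> y" by (simp add: y_def)
      also have "y \<le> y ^ (s n + 1)" using y by (intro self_le_power) auto
      finally show "1 / e \<le> y ^ (s n + 1)" .
    qed simp
    then have "norm (\<gamma> - \<beta> n) * (1 / e) < 1" using elim by linarith
    then show ?case using assms by (simp add: field_simps)
  qed
qed

lemma eventually_bounded: "eventually (\<lambda>n. norm (\<beta> n) \<le> norm \<gamma> + 1) sequentially"
  using error_tendsto_zero[of 1, simplified]
proof eventually_elim
  case (elim n)
  have "norm (\<beta> n) \<le> norm \<gamma> + norm (\<gamma> - \<beta> n)" by norm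
  with elim show ?case by linarith
qed

text \<open>
  Integers that converge are eventually constant.
\<close>
lemma infinitely_many_nonintegral: "infinite {n. \<beta> n \<notin> \<int>}"
proof
  assume "finite {n. \<beta> n \<notin> \<int>}"
  then have ev: "eventually (\<lambda>n. \<beta> n \<in> \<int>) sequentially"
    by (simp add: cofinite_eq_sequentially[symmetric] eventually_cofinite)
  have small: "eventually (\<lambda>n. norm (\<gamma> - \<beta> n) < 1/2) sequentially"
    by (rule error_tendsto_zero) simp
  have "eventually (\<lambda>n. \<beta> (Suc n) = \<beta> n) sequentially"
    using ev small eventually_all_ge_at_top[OF ev] eventually_all_ge_at_top[OF small]
  proof eventually_elim
    case (elim n)
    then have int: "\<beta> (Suc n) - \<beta> n \<in> \<int>" and sm: "norm (\<gamma> - \<beta> n) < 1/2" "norm (\<gamma> - \<beta> (Suc n)) < 1/2"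
      by auto
    have "norm (\<beta> (Suc n) - \<beta> n) \<le> norm (\<gamma> - \<beta> n) + norm (\<gamma> - \<beta> (Suc n))" by norm
    then have "norm (\<beta> (Suc n) - \<beta> n) < 1" using sm by linarith
    moreover obtain z where z: "\<beta> (Suc n) - \<beta> n = of_int z" using int by (auto elim: Ints_cases)
    ultimately have "\<bar>real_of_int z\<bar> < 1" by simp
    then have "z = 0" by linarith
    then show ?case using z by simp
  qed
  then have "finite {n. \<beta> (Suc n) \<noteq> \<beta> n}"
    by (simp add: cofinite_eq_sequentially[symmetric] eventually_cofinite)
  with not_eventually_const show False by simp
qed

lemma degree_of_nonintegral:
  assumes "\<beta> n \<notin> \<int>"
  shows "algebraic_degree (\<beta> n) = m"
proof -
  obtain q where q: "\<beta> n = rat_poly_at q a" using bounded_combs_as_rat_poly coords by blast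
  have "\<beta> n \<notin> \<rat>" using rational_bounded_combs_is_int[OF degree_root coords] assms by blast
  then show ?thesis using simple_algebraic_degree[OF simple_root q] degree_root by simp
qed

lemma algebraic_approximant: "algebraic (\<beta> n)"
proof -
  obtain q where q: "\<beta> n = rat_poly_at q a" using bounded_combs_as_rat_poly coords by blast
  then show ?thesis
    using rat_poly_at_algebraic_degree_le(1) simple_root unfolding simple_algebraic_def by simp
qed

lemma power_split:
  fixes c z :: real and i j :: nat
  assumes "c \<ge> 1" "z \<ge> 0" "j \<ge> 1"
  shows "c * z ^ (i * j) \<le> (c * z ^ i) ^ j"
  using self_le_power[of c j] assms by (auto simp: power_mult_distrib power_mult intro!: mult_right_mono)

text \<open>
  If \<open>q(\<gamma>) = 0\<close>, then for large \<open>n\<close> the approximant \<open>\<beta> n\<close> is closer to \<open>\<gamma>\<close> than all other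
  roots of \<open>q\<close>. Unless it equals \<open>\<gamma>\<close>, the Liouville inequality for \<open>\<delta> = \<gamma>\<close> contradicts the
  smallness of the error.
\<close>
lemma transcendental: "\<not> algebraic \<gamma>"
proof
  assume "algebraic \<gamma>"
  then obtain q where q: "q \<noteq> 0" "int_poly_at q \<gamma> = 0" by (rule algebraicE')
  define B where "B = norm \<gamma> + 1"
  define H where "H = real_of_int (poly_height q)"
  have H: "H \<ge> 1" using poly_height_ge_1[OF q(1)] by (simp add: H_def)
  obtain C M where C: "C \<ge> 1" and liouville: "\<forall>E\<ge>1. \<forall>H\<ge>1. \<forall>x\<in>bounded_combs E. \<forall>q' \<delta>.
       norm x \<le> B \<and> norm \<delta> \<le> B \<and> Polynomial.degree q' \<le> Polynomial.degree q \<and> real_of_int (poly_height q') \<le> H \<and>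
       int_poly_at q' \<delta> = 0 \<and> int_poly_at q' x \<noteq> 0 \<longrightarrow> 1 \<le> norm (x - \<delta>) * (C * (H * E) ^ M)"
    using liouville_inequality[of B "Polynomial.degree q"] by (auto simp: B_def)
  define y where "y = C * H ^ M * L ^ M"
  have CH: "C * H ^ M \<ge> 1" using C H by (intro mult_ge1_I one_le_power) auto
  have y: "y \<ge> 1" unfolding y_def using mult_ge1_I[OF CH one_le_power[OF L]] .
  have "finite {x. int_poly_at q x = 0}"
    by (rule poly_roots_finite) (use q in \<open>simp add: map_poly_eq_0_iff\<close>)
  then obtain d where d: "d > 0" "\<And>x. int_poly_at q x = 0 \<Longrightarrow> x \<noteq> \<gamma> \<Longrightarrow> d \<le> dist \<gamma> x"
    using finite_set_avoid[of "{x. int_poly_at q x = 0}" \<gamma>] by auto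
  have ev: "eventually (\<lambda>n. \<beta> n = \<gamma>) sequentially"
    using error_dominated[OF y] eventually_bounded error_tendsto_zero[OF d(1)]
  proof eventually_elim
    case (elim n)
    show ?case
    proof (rule ccontr)
      assume ne: "\<beta> n \<noteq> \<gamma>"
      have "int_poly_at q (\<beta> n) \<noteq> 0" using d(2)[of "\<beta> n"] ne elim(3) by (auto simp: dist_norm)
      then have "1 \<le> norm (\<beta> n - \<gamma>) * (C * (H * L ^ (s n + 1)) ^ M)"
        using elim(2) q(2)
        by (intro liouville[rule_format, where q' = q, OF one_le_power[OF L] H coords] conjI)
          (auto simp: B_def H_def)
      also have "C * (H * L ^ (s n + 1)) ^ M = (C * H ^ M) * L ^ (M * (s n + 1))"
        by (simp only: power_mult_distrib power_mult[symmetric] mult_ac)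
      also have "norm (\<beta> n - \<gamma>) * \<dots> \<le> norm (\<beta> n - \<gamma>) * y ^ (s n + 1)"
        unfolding y_def using CH L by (intro mult_left_mono power_split) auto
      finally show False using elim(1) by (simp add: norm_minus_commute)
    qed
  qed
  have "eventually (\<lambda>n. \<beta> (Suc n) = \<beta> n) sequentially"
    using eventually_all_ge_at_top[OF ev] by eventually_elim auto
  then have "finite {n. \<beta> (Suc n) \<noteq> \<beta> n}"
    by (simp add: cofinite_eq_sequentially[symmetric] eventually_cofinite)
  with not_eventually_const show False by simp
qed

text \<open>
  The approximants of degree \<open>m\<close> satisfy the required inequality as soon as the error is below the
  \<open>w\<close>-th negative power of the height bound from Siegel's lemma. They take infinitely many values, since a
  value taken infinitely often would be the limit \<open>\<gamma>\<close>, which is not algebraic.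
\<close>
lemma well_approximable_by_degree: "well_approximable m \<gamma>"
  unfolding well_approximable_def
proof (intro allI impI)
  fix w :: real assume w: "w > 0"
  let ?S = "{x. algebraic x \<and> algebraic_degree x = m \<and>
               norm (\<gamma> - x) < real_of_int (poly_height (int_minpoly x)) powr (- w)}"
  obtain C where C: "C \<ge> 1" and ann: "\<forall>E\<ge>1. \<forall>x\<in>bounded_combs E.
       \<exists>q. q \<noteq> 0 \<and> Polynomial.degree q \<le> m \<and> int_poly_at q x = 0 \<and>
           real_of_int (poly_height q) \<le> C * E ^ (m * m)"
    using small_annihilating_poly by blast
  define z where "z = C * L ^ (m * m)"
  have z: "z \<ge> 1" unfolding z_def using mult_ge1_I[OF C one_le_power[OF L]] .
  have y: "z powr w \<ge> 1" using z w by (simp add: ge_one_powr_ge_zero)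
  have good: "eventually (\<lambda>n. \<beta> n \<notin> \<int> \<longrightarrow> \<beta> n \<in> ?S) sequentially"
    using error_dominated[OF y]
  proof eventually_elim
    case (elim n)
    show ?case
    proof
      assume "\<beta> n \<notin> \<int>"
      then have deg: "algebraic_degree (\<beta> n) = m" by (rule degree_of_nonintegral)
      have "L ^ (s n + 1) \<ge> 1" using L by (intro one_le_power)
      then obtain q where q: "q \<noteq> 0" "Polynomial.degree q \<le> m" "int_poly_at q (\<beta> n) = 0"
        "real_of_int (poly_height q) \<le> C * (L ^ (s n + 1)) ^ (m * m)"
        using ann coords[of n] by blast
      define h where "h = real_of_int (poly_height (int_minpoly (\<beta> n)))"
      have "int_minpoly (\<beta> n) \<noteq> 0"
        using int_minpoly_properties(1)[OF algebraic_approximant] by (metis Factorial_Ring.not_irreducible_zero)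
      then have h: "h \<ge> 1" using poly_height_ge_1 by (simp add: h_def)
      have "h \<le> real_of_int (poly_height q)"
        unfolding h_def using int_minpoly_height_le[OF q(1,3)] q(2) deg by simp
      also have "\<dots> \<le> C * L ^ (m * m * (s n + 1))"
        using q(4) by (simp only: power_mult[symmetric] mult_ac)
      also have "\<dots> \<le> z ^ (s n + 1)"
        unfolding z_def using C L by (intro power_split) auto
      finally have "(z ^ (s n + 1)) powr (- w) \<le> h powr (- w)"
        using h w by (intro powr_mono2') auto
      moreover have "(z ^ (s n + 1)) powr (- w) = 1 / (z powr w) ^ (s n + 1)"
      proof -
        have "(z powr w) ^ (s n + 1) = (z ^ (s n + 1)) powr w"
          using z by (simp add: powr_powr powr_realpow[symmetric] mult.commute powr_mult powr_add del: of_nat_Suc)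
        then show ?thesis by (simp add: powr_minus_divide)
      qed
      moreover have "norm (\<gamma> - \<beta> n) < 1 / (z powr w) ^ (s n + 1)"
        using elim z by (simp add: field_simps)
      ultimately have "norm (\<gamma> - \<beta> n) < h powr (- w)" by linarith
      then show "\<beta> n \<in> ?S" using algebraic_approximant deg by (simp add: h_def)
    qed
  qed
  define I where "I = {n. \<beta> n \<notin> \<int> \<and> \<beta> n \<in> ?S}"
  have "finite {n. \<not> (\<beta> n \<notin> \<int> \<longrightarrow> \<beta> n \<in> ?S)}"
    using good by (simp only: cofinite_eq_sequentially[symmetric] eventually_cofinite)
  then have "infinite ({n. \<beta> n \<notin> \<int>} - {n. \<not> (\<beta> n \<notin> \<int> \<longrightarrow> \<beta> n \<in> ?S)})"
    using infinitely_many_nonintegral by (rule Diff_infinite_finite)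
  moreover have "{n. \<beta> n \<notin> \<int>} - {n. \<not> (\<beta> n \<notin> \<int> \<longrightarrow> \<beta> n \<in> ?S)} \<subseteq> I" by (auto simp: I_def)
  ultimately have inf: "infinite I" using infinite_super by blast
  show "infinite ?S"
  proof
    assume "finite ?S"
    then have "finite (\<beta> ` I)" by (rule rev_finite_subset) (auto simp: I_def)
    then obtain n0 where n0: "infinite {n \<in> I. \<beta> n = \<beta> n0}"
      using pigeonhole_infinite[OF inf] by blast
    have "\<gamma> = \<beta> n0"
    proof (rule ccontr)
      assume "\<gamma> \<noteq> \<beta> n0"
      then have "norm (\<gamma> - \<beta> n0) > 0" by simp
      then have "finite {n. \<not> (norm (\<gamma> - \<beta> n) < norm (\<gamma> - \<beta> n0))}"
        using error_tendsto_zero by (simp only: cofinite_eq_sequentially[symmetric] eventually_cofinite)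
      moreover have "{n \<in> I. \<beta> n = \<beta> n0} \<subseteq> {n. \<not> (norm (\<gamma> - \<beta> n) < norm (\<gamma> - \<beta> n0))}" by auto
      ultimately show False using n0 finite_subset by blast
    qed
    then show False using transcendental algebraic_approximant by metis
  qed
qed

text \<open>
  A common root with the minimal polynomial of \<open>\<delta>\<close> has the degree of \<open>\<delta>\<close>, which is less than \<open>m\<close>,
  and so is an integer; then \<open>\<delta>\<close> is that integer.
\<close>
lemma distinct_from_smaller_degree:
  assumes "algebraic \<delta>" "algebraic_degree \<delta> < m" "\<delta> \<notin> \<int>"
  shows "int_poly_at (int_minpoly \<delta>) (\<beta> n) \<noteq> 0"
proof
  assume eq: "int_poly_at (int_minpoly \<delta>) (\<beta> n) = 0"
  note q = int_minpoly_properties[OF assms(1)]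
  have deg: "algebraic_degree (\<beta> n) = algebraic_degree \<delta>"
    using degree_irreducible_int_poly[OF q(1) eq] q(3) by simp
  then have "\<beta> n \<in> \<int>" using degree_of_nonintegral assms(2) by fastforce
  then obtain z where z: "\<beta> n = of_int z" by (auto elim: Ints_cases)
  have "int_poly_at [:- z, 1:] (\<beta> n) = 0" by (simp add: z map_poly_pCons)
  then have "int_minpoly \<delta> dvd [:- z, 1:]" using irreducible_int_poly_dvd[OF q(1) eq] by blast
  then obtain u where "[:- z, 1:] = int_minpoly \<delta> * u" by blast
  then have "int_poly_at [:- z, 1:] \<delta> = 0" using int_poly_at_mult[of "int_minpoly \<delta>" u \<delta>] q(2) by simp
  then have "\<delta> = of_int z" by (simp add: map_poly_pCons)
  then show False using assms(3) by simp
qed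

text \<open>
  The decay \<open>\<rho> ^ t n\<close> is split into two equal parts with \<open>\<sigma>\<^sup>2 = \<rho>\<close>. One factor \<open>\<sigma> ^ t n\<close>
  absorbs the coordinates of \<open>\<beta> n\<close> for all large \<open>n\<close>. The other absorbs the height \<open>H\<close> of \<open>\<delta>\<close>
  once \<open>t n \<ge> T\<close>, where \<open>T\<close> is a multiple of the binary logarithm \<open>j\<close> of \<open>H\<close>. For the least
  such \<open>n\<close> the bound on \<open>s n / t (n - 1)\<close> gives \<open>s n \<le> R T\<close> up to a constant, so everything that
  the Liouville inequality loses is a power of \<open>H\<close>.
\<close>
lemma lower_bound_smaller_degree:
  assumes "k < m"
  shows "\<exists>c W. \<forall>\<delta>. algebraic \<delta> \<and> algebraic_degree \<delta> = k \<and> \<delta> \<notin> \<int> \<and> norm (\<gamma> - \<delta>) \<le> 1 \<longrightarrow>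
     1 \<le> c * norm (\<gamma> - \<delta>) * real_of_int (poly_height (int_minpoly \<delta>)) ^ W"
proof -
  define B where "B = norm \<gamma> + 1"
  obtain C M where C: "C \<ge> 1" and liouville: "\<forall>E\<ge>1. \<forall>H\<ge>1. \<forall>x\<in>bounded_combs E. \<forall>q \<delta>.
       norm x \<le> B \<and> norm \<delta> \<le> B \<and> Polynomial.degree q \<le> k \<and> real_of_int (poly_height q) \<le> H \<and>
       int_poly_at q \<delta> = 0 \<and> int_poly_at q x \<noteq> 0 \<longrightarrow> 1 \<le> norm (x - \<delta>) * (C * (H * E) ^ M)"
    using liouville_inequality[of B k] by (auto simp: B_def)
  define \<sigma> where "\<sigma> = sqrt \<rho>"
  have \<sigma>: "0 < \<sigma>" "\<sigma> < 1" and \<sigma>_sq: "\<sigma> * \<sigma> = \<rho>" using \<rho> by (auto simp: \<sigma>_def real_sqrt_lt_1_iff)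
  define y where "y = 2 * C * L ^ M"
  have y: "y \<ge> 1" unfolding y_def using C by (intro mult_ge1_I one_le_power L) auto
  obtain n1 where n1: "\<And>n. n \<ge> n1 \<Longrightarrow> n \<ge> 1" "\<And>n. n \<ge> n1 \<Longrightarrow> norm (\<beta> n) \<le> B"
    "\<And>n. n \<ge> n1 \<Longrightarrow> C\<^sub>0 * \<sigma> ^ t n * y ^ (s n + 1) < 1"
    using eventually_conj[OF eventually_ge_at_top[of 1] eventually_conj[OF eventually_bounded gap_dominates[OF \<sigma> y]]]
    unfolding eventually_sequentially B_def by blast
  \<comment> \<open>The numbers \<open>e\<close> and \<open>l\<close> express \<open>1 / \<sigma>\<close> and \<open>L\<close> in powers of 2, in which \<open>H\<close> is measured.\<close>
  obtain e where e: "\<sigma> ^ e < 1 / 2" using real_arch_pow_inv[of "1/2" \<sigma>] \<sigma> by auto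
  obtain l :: nat where l: "L < 2 ^ l" using real_arch_pow[of 2 L] by auto
  define V where "V = l * (R * (e * M) * M)"
  define c where "c = 2 * C * L ^ ((s n1 + 1) * M) * 2 ^ V"
  have bound: "1 \<le> c * norm (\<gamma> - \<delta>) * H ^ (M + V)"
    if \<delta>: "algebraic \<delta>" "algebraic_degree \<delta> = k" "\<delta> \<notin> \<int>" "norm (\<gamma> - \<delta>) \<le> 1"
      and H_def: "H = real_of_int (poly_height (int_minpoly \<delta>))" for \<delta> H
  proof -
    note q = int_minpoly_properties[OF \<delta>(1)]
    have "int_minpoly \<delta> \<noteq> 0" using q(1) by (metis Factorial_Ring.not_irreducible_zero)
    then have H: "H \<ge> 1" using poly_height_ge_1 by (simp add: H_def)
    have "norm \<delta> \<le> norm \<gamma> + norm (\<gamma> - \<delta>)" by norm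
    then have norm_\<delta>: "norm \<delta> \<le> B" using \<delta>(4) by (simp add: B_def)
    obtain j where j: "H \<le> 2 ^ j" "2 ^ j \<le> 2 * H" using exists_close_power_of_two[OF H] .
    define T where "T = e * M * j"
    define n where "n = (LEAST n. n \<ge> n1 \<and> t n \<ge> T)"
    have n: "n \<ge> n1 \<and> t n \<ge> T"
      unfolding n_def by (rule LeastI[of _ "max n1 T"]) (use t_ge[of "max n1 T"] in auto)
    have s_le: "s n + 1 \<le> s n1 + 1 + R * T"
    proof (cases "n = n1")
      case False
      then have "n - 1 \<ge> n1" "n \<ge> 1" using n by auto
      moreover have "\<not> (n - 1 \<ge> n1 \<and> t (n - 1) \<ge> T)"
        using not_less_Least[of "n - 1" "\<lambda>n. n \<ge> n1 \<and> t n \<ge> T"] \<open>n \<ge> 1\<close> unfolding n_def[symmetric] by simp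
      ultimately have "t (n - 1) \<le> T" "n - 1 \<ge> 1" using n1(1) by auto
      then have "R * t (n - 1) \<le> R * T" by (intro mult_le_mono2)
      moreover have "s n \<le> R * t (n - 1)"
        using block_ratio[OF \<open>n - 1 \<ge> 1\<close>] \<open>n \<ge> 1\<close> by simp
      ultimately have "s n \<le> R * T" by (rule le_trans[rotated])
      then show ?thesis by simp
    qed simp
    have "\<sigma> ^ t n \<le> \<sigma> ^ T" using \<sigma> n by (intro power_decreasing) auto
    also have "\<dots> = ((\<sigma> ^ e) ^ j) ^ M" by (simp add: T_def power_mult[symmetric] mult_ac)
    also have "\<dots> \<le> ((1 / 2) ^ j) ^ M" using e \<sigma> by (intro power_mono) auto
    also have "\<dots> \<le> (1 / H) ^ M" using j(1) H by (intro power_mono) (auto simp: power_one_over field_simps)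
    finally have \<sigma>H: "\<sigma> ^ t n * H ^ M \<le> 1" using H by (simp add: power_one_over field_simps)
    define Z where "Z = C * (H * L ^ (s n + 1)) ^ M"
    have Z: "Z = C * L ^ (M * (s n + 1)) * H ^ M"
      unfolding Z_def by (simp only: power_mult_distrib power_mult[symmetric] mult_ac)
    have "C\<^sub>0 * \<rho> ^ t n * (2 * Z) = C\<^sub>0 * \<sigma> ^ t n * ((2 * C) * L ^ (M * (s n + 1))) * (\<sigma> ^ t n * H ^ M)"
      unfolding Z \<sigma>_sq[symmetric] power_mult_distrib[of \<sigma> \<sigma>] by (simp only: mult_ac)
    also have "\<dots> \<le> C\<^sub>0 * \<sigma> ^ t n * y ^ (s n + 1) * 1"
      unfolding y_def using C C\<^sub>0 L \<sigma> \<sigma>H H by (intro mult_mono mult_left_mono power_split) auto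
    also have "\<dots> \<le> 1" using n1(3)[of n] n by simp
    finally have small: "C\<^sub>0 * \<rho> ^ t n * Z \<le> 1 / 2" by simp
    have Z0: "Z \<ge> 0" unfolding Z_def using C H L by simp
    have "1 \<le> norm (\<beta> n - \<delta>) * Z"
    proof -
      have "int_poly_at (int_minpoly \<delta>) (\<beta> n) \<noteq> 0"
        using distinct_from_smaller_degree[OF \<delta>(1) _ \<delta>(3)] \<delta>(2) assms by simp
      then show ?thesis unfolding Z_def
        using n1(2)[of n] n norm_\<delta> q(2,3) \<delta>(2)
        by (intro liouville[rule_format, where q = "int_minpoly \<delta>", OF one_le_power[OF L] H coords] conjI)
          (auto simp: H_def)
    qed
    also have "\<dots> \<le> (norm (\<gamma> - \<delta>) + C\<^sub>0 * \<rho> ^ t n) * Z"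
    proof (intro mult_right_mono Z0)
      have "norm (\<beta> n - \<delta>) \<le> norm (\<gamma> - \<delta>) + norm (\<gamma> - \<beta> n)" by norm
      then show "norm (\<beta> n - \<delta>) \<le> norm (\<gamma> - \<delta>) + C\<^sub>0 * \<rho> ^ t n" using error[of n] n1(1)[of n] n by linarith
    qed
    finally have *: "1 \<le> 2 * (norm (\<gamma> - \<delta>) * Z)" using small by (simp add: algebra_simps)
    have "L ^ (M * (s n + 1)) \<le> L ^ ((s n1 + 1) * M) * (2 * H) ^ V"
    proof -
      have "L ^ (M * (s n + 1)) \<le> L ^ (M * (s n1 + 1 + R * T))"
        using s_le by (intro power_increasing L mult_le_mono2)
      also have "\<dots> = L ^ ((s n1 + 1) * M) * L ^ (j * (R * (e * M) * M))"
        by (simp add: T_def power_add[symmetric] algebra_simps)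
      also have "L ^ (j * (R * (e * M) * M)) \<le> (2 ^ l) ^ (j * (R * (e * M) * M))"
        using l L by (intro power_mono) auto
      also have "(2 ^ l) ^ (j * (R * (e * M) * M)) = (2 ^ j :: real) ^ V"
        unfolding V_def by (simp only: power_mult[symmetric] mult_ac)
      also have "\<dots> \<le> (2 * H) ^ V" using j by (intro power_mono) auto
      finally show ?thesis using L by simp
    qed
    then have "Z \<le> C * (L ^ ((s n1 + 1) * M) * (2 * H) ^ V) * H ^ M"
      unfolding Z using C H L by (intro mult_mono mult_left_mono) auto
    then have "2 * (norm (\<gamma> - \<delta>) * Z) \<le> 2 * (norm (\<gamma> - \<delta>) * (C * (L ^ ((s n1 + 1) * M) * (2 * H) ^ V) * H ^ M))"
      by (intro mult_left_mono) auto
    also have "\<dots> = c * norm (\<gamma> - \<delta>) * H ^ (M + V)"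
      by (simp add: c_def power_add power_mult_distrib mult_ac)
    finally show ?thesis using * by linarith
  qed
  show ?thesis using bound by blast
qed

text \<open>
  With exponent \<open>W + 1\<close>, one more than in the lower bound, a good approximation of degree \<open>k\<close> is either
  one of the finitely many integers near \<open>\<gamma>\<close> or has height at most \<open>\<bar>c\<bar>\<close>.
\<close>
lemma not_well_approximable_smaller_degree:
  assumes "k < m"
  shows "\<not> well_approximable k \<gamma>"
proof
  assume wa: "well_approximable k \<gamma>"
  obtain c W where c: "\<forall>\<delta>. algebraic \<delta> \<and> algebraic_degree \<delta> = k \<and> \<delta> \<notin> \<int> \<and> norm (\<gamma> - \<delta>) \<le> 1 \<longrightarrow>
     1 \<le> c * norm (\<gamma> - \<delta>) * real_of_int (poly_height (int_minpoly \<delta>)) ^ W"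
    using lower_bound_smaller_degree[OF assms] by blast
  let ?S = "{x. algebraic x \<and> algebraic_degree x = k \<and>
               norm (\<gamma> - x) < real_of_int (poly_height (int_minpoly x)) powr (- real (Suc W))}"
  have "?S \<subseteq> {x. x \<in> \<int> \<and> norm (\<gamma> - x) \<le> 1} \<union>
      {x. algebraic x \<and> algebraic_degree x \<le> k \<and> real_of_int (poly_height (int_minpoly x)) \<le> \<bar>c\<bar>}"
  proof
    fix x assume "x \<in> ?S"
    then have x: "algebraic x" "algebraic_degree x = k"
      and close: "norm (\<gamma> - x) < real_of_int (poly_height (int_minpoly x)) powr (- real (Suc W))" by auto
    define H where "H = real_of_int (poly_height (int_minpoly x))"
    have "int_minpoly x \<noteq> 0"
      using int_minpoly_properties(1)[OF x(1)] by (metis Factorial_Ring.not_irreducible_zero)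
    then have H: "H \<ge> 1" using poly_height_ge_1 by (simp add: H_def)
    have powr: "H powr (- real (Suc W)) = 1 / H ^ Suc W"
      using H by (simp only: powr_minus_divide powr_realpow)
    then have lt: "norm (\<gamma> - x) < 1 / H ^ Suc W" using close by (simp add: H_def)
    also have "\<dots> \<le> 1" using one_le_power[OF H, of "Suc W"] by simp
    finally have le1: "norm (\<gamma> - x) \<le> 1" by simp
    have "H \<le> \<bar>c\<bar>" if "x \<notin> \<int>"
    proof -
      have "1 \<le> c * norm (\<gamma> - x) * H ^ W" unfolding H_def using c x that le1 by blast
      also have "\<dots> \<le> \<bar>c\<bar> * (1 / H ^ Suc W) * H ^ W"
        using lt H by (intro mult_right_mono mult_mono) auto
      also have "\<dots> = \<bar>c\<bar> / H" using H by simp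
      finally show ?thesis using H by (simp add: le_divide_eq)
    qed
    then show "x \<in> {x. x \<in> \<int> \<and> norm (\<gamma> - x) \<le> 1} \<union>
      {x. algebraic x \<and> algebraic_degree x \<le> k \<and> real_of_int (poly_height (int_minpoly x)) \<le> \<bar>c\<bar>}"
      using x le1 by (auto simp: H_def)
  qed
  moreover have "finite ({x. x \<in> \<int> \<and> norm (\<gamma> - x) \<le> 1} \<union>
      {x. algebraic x \<and> algebraic_degree x \<le> k \<and> real_of_int (poly_height (int_minpoly x)) \<le> \<bar>c\<bar>})"
    by (intro finite_UnI finite_near_ints finite_algebraic_bounded_height)
  ultimately have "finite ?S" by (rule finite_subset)
  moreover have "infinite ?S"
    using wa[unfolded well_approximable_def, THEN spec, of "real (Suc W)"] by simp
  ultimately show False by blast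
qed

theorem limit_in_U_numbers: "\<gamma> \<in> U_numbers m"
  unfolding U_numbers_def
  using transcendental degree_pos well_approximable_by_degree not_well_approximable_smaller_degree by blast

end

section \<open>Values of generalized Liouville series\<close>

definition partial_value :: "complex fps \<Rightarrow> (nat \<Rightarrow> nat) \<Rightarrow> complex \<Rightarrow> nat \<Rightarrow> complex" where
  "partial_value f s z n = (\<Sum>k\<le>s n. fps_nth f k * z ^ k)"

lemma generalized_liouvilleD:
  assumes "generalized_liouville f s t"
  shows "fps_nth f k \<in> \<int>"
    and "n \<ge> 1 \<Longrightarrow> t (n - 1) \<le> s n \<and> s n < t n"
    and "n \<ge> 1 \<Longrightarrow> s n < k \<Longrightarrow> k < t n \<Longrightarrow> fps_nth f k = 0"
    and "filterlim (\<lambda>n. real (t n) / real (s n)) at_top sequentially"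
    and "\<exists>R. \<forall>n\<ge>1. s (Suc n) \<le> R * t n"
proof -
  note * = assms[unfolded generalized_liouville_def]
  show "fps_nth f k \<in> \<int>" "n \<ge> 1 \<Longrightarrow> s n < k \<Longrightarrow> k < t n \<Longrightarrow> fps_nth f k = 0"
    "filterlim (\<lambda>n. real (t n) / real (s n)) at_top sequentially"
    using * by blast+
  show gaps: "t (n - 1) \<le> s n \<and> s n < t n" if "n \<ge> 1" for n using * that by blast
  obtain C where C: "\<And>n. n \<ge> 1 \<Longrightarrow> real (s (n + 1)) / real (t n) \<le> C" using * by blast
  have "s (Suc n) \<le> nat \<lceil>C\<rceil> * t n" if n: "n \<ge> 1" for n
  proof -
    have "t n > 0" using gaps[OF n] by simp
    then have "real (s (Suc n)) \<le> C * real (t n)" using C[OF n] by (simp add: divide_le_eq)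
    also have "\<dots> \<le> real (nat \<lceil>C\<rceil>) * real (t n)" by (intro mult_right_mono) (auto simp: real_nat_ceiling_ge)
    finally show ?thesis by (simp only: of_nat_mult[symmetric] of_nat_le_iff)
  qed
  then show "\<exists>R. \<forall>n\<ge>1. s (Suc n) \<le> R * t n" by blast
qed

text \<open>
  Cauchy's estimate at a radius \<open>r\<close> strictly between \<open>\<bar>z\<bar>\<close> and the radius of convergence. Taking the
  maximum with \<open>1/2\<close> keeps \<open>\<rho>\<close> positive when \<open>z = 0\<close>.
\<close>
lemma fps_coeff_bounds:
  fixes f :: "complex fps"
  assumes "ereal (norm z) < fps_conv_radius f"
  obtains A D \<rho> where "A \<ge> 1" "D \<ge> 1" "0 < \<rho>" "\<rho> < 1"
    "\<And>k. norm (fps_nth f k) \<le> A * D ^ k" "\<And>k. norm (fps_nth f k * z ^ k) \<le> A * \<rho> ^ k"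
proof -
  obtain r where r: "norm z < r" "ereal r < fps_conv_radius f"
    using ereal_dense2[OF assms] by auto
  then have r0: "r > 0" using norm_ge_zero[of z] by linarith
  have sm: "summable (\<lambda>k. norm (fps_nth f k * of_real r ^ k))"
    using r r0 by (intro norm_summable_fps) auto
  define A where "A = max 1 (\<Sum>k. norm (fps_nth f k * of_real r ^ k))"
  have A: "norm (fps_nth f k) * r ^ k \<le> A" for k
  proof -
    have "norm (fps_nth f k * of_real r ^ k) \<le> (\<Sum>k. norm (fps_nth f k * of_real r ^ k))"
      using sum_le_suminf[OF sm, of "{k}"] by simp
    then show ?thesis using r0 by (simp add: A_def norm_mult norm_power)
  qed
  define D where "D = max 1 (1 / r)"
  define \<rho> where "\<rho> = max (1/2) (norm z / r)"
  have A0: "A \<ge> 1" by (simp add: A_def)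
  show thesis
  proof (rule that[of A D \<rho>])
    show "A \<ge> 1" by fact
    show "D \<ge> 1" "0 < \<rho>" "\<rho> < 1" using r r0 by (auto simp: D_def \<rho>_def)
    fix k
    have "norm (fps_nth f k) \<le> A * (1 / r) ^ k" using A[of k] r0 by (simp add: power_divide field_simps)
    also have "\<dots> \<le> A * D ^ k" using A0 r0 by (intro mult_left_mono power_mono) (auto simp: D_def)
    finally show "norm (fps_nth f k) \<le> A * D ^ k" .
    have "norm (fps_nth f k * z ^ k) = norm (fps_nth f k) * r ^ k * (norm z / r) ^ k"
      using r0 by (simp add: norm_mult norm_power power_divide)
    also have "\<dots> \<le> A * \<rho> ^ k"
      using A[of k] A0 r0 by (intro mult_mono power_mono) (auto simp: \<rho>_def)
    finally show "norm (fps_nth f k * z ^ k) \<le> A * \<rho> ^ k" .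
  qed
qed

lemma partial_value_error:
  assumes gap: "\<And>k. s n < k \<Longrightarrow> k < t n \<Longrightarrow> fps_nth f k = 0" and "s n < t n"
    and conv: "ereal (norm z) < fps_conv_radius f"
    and \<rho>: "0 < \<rho>" "\<rho> < 1" and bound: "\<And>k. norm (fps_nth f k * z ^ k) \<le> A * \<rho> ^ k"
  shows "norm (eval_fps f z - partial_value f s z n) \<le> A / (1 - \<rho>) * \<rho> ^ t n"
proof -
  define g where "g = (\<lambda>k. fps_nth f k * z ^ k)"
  have "summable g" unfolding g_def using conv by (rule summable_fps)
  then have "eval_fps f z = (\<Sum>k. g (k + t n)) + (\<Sum>k<t n. g k)"
    unfolding eval_fps_def g_def[symmetric] by (rule suminf_split_initial_segment)
  also have "(\<Sum>k<t n. g k) = partial_value f s z n"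
    unfolding partial_value_def g_def using assms(2)
    by (intro sum.mono_neutral_right) (auto simp: gap)
  finally have "eval_fps f z - partial_value f s z n = (\<Sum>k. g (k + t n))" by simp
  also have "norm \<dots> \<le> (\<Sum>k. A * \<rho> ^ t n * \<rho> ^ k)"
  proof (rule norm_suminf_le)
    show "norm (g (k + t n)) \<le> A * \<rho> ^ t n * \<rho> ^ k" for k
      using bound[of "k + t n"] by (simp add: g_def power_add mult_ac)
    show "summable (\<lambda>k. A * \<rho> ^ t n * \<rho> ^ k)" using \<rho> by (intro summable_mult summable_geometric) auto
  qed
  also have "\<dots> = A / (1 - \<rho>) * \<rho> ^ t n"
    using \<rho> by (simp add: suminf_mult suminf_geometric summable_geometric)
  finally show ?thesis .
qed

lemma partial_value_step:
  assumes "generalized_liouville f s t" "n \<ge> 1"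
  shows "partial_value f s z (Suc n) - partial_value f s z n = poly (block_poly f s t (Suc n)) z"
proof -
  note gl = generalized_liouvilleD[OF assms(1)]
  have le: "s n < t n" "t n \<le> s (Suc n)" using gl(2)[OF assms(2)] gl(2)[of "Suc n"] by auto
  have "partial_value f s z (Suc n) = partial_value f s z n + (\<Sum>k\<in>{s n<..s (Suc n)}. fps_nth f k * z ^ k)"
    unfolding partial_value_def
    by (subst sum.union_disjoint[symmetric]) (use le in \<open>auto intro!: sum.cong\<close>)
  also have "(\<Sum>k\<in>{s n<..s (Suc n)}. fps_nth f k * z ^ k) = (\<Sum>k=t n..s (Suc n). fps_nth f k * z ^ k)"
    by (rule sum.mono_neutral_right) (use le gl(3)[OF assms(2)] in auto)
  also have "\<dots> = poly (block_poly f s t (Suc n)) z"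
    by (simp add: block_poly_def poly_sum poly_monom)
  finally show ?thesis by simp
qed

text \<open>
  The term of index \<open>k\<close> has coordinates at most \<open>A (D growth) ^ k\<close>; the number of terms is absorbed by
  \<open>s n + 1 \<le> 2 ^ (s n + 1)\<close>.
\<close>
lemma (in monic_root) partial_value_bounded_combs:
  assumes "\<And>k. fps_nth f k \<in> \<int>" "A \<ge> 1" "D \<ge> 1" "\<And>k. norm (fps_nth f k) \<le> A * D ^ k"
  shows "partial_value f s a n \<in> bounded_combs ((2 * A * (D * growth)) ^ (s n + 1))"
proof -
  have "\<exists>b. fps_nth f k = of_int b" for k using assms(1)[of k] by (auto elim: Ints_cases)
  then obtain b :: "nat \<Rightarrow> int" where b: "\<And>k. fps_nth f k = of_int (b k)" by metis
  define z where "z = D * growth"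
  have z: "z \<ge> 1" unfolding z_def using assms growth_ge_1 by (intro mult_ge1_I)
  have "partial_value f s a n = (\<Sum>k\<le>s n. of_int (b k) * (a ^ k * 1))"
    by (simp add: partial_value_def b)
  also have "\<dots> \<in> bounded_combs (\<Sum>k\<le>s n. (A * D ^ k) * (growth ^ k * 1))"
  proof (intro bounded_combs_sum bounded_combs_scale bounded_combs_times_root_power bounded_combs_one)
    show "\<bar>real_of_int (b k)\<bar> \<le> A * D ^ k" for k using assms(4)[of k] by (simp add: b)
  qed simp
  also have "(\<Sum>k\<le>s n. (A * D ^ k) * (growth ^ k * 1)) = (\<Sum>k\<le>s n. A * z ^ k)"
    by (simp add: z_def power_mult_distrib mult.assoc)
  finally have *: "partial_value f s a n \<in> bounded_combs (\<Sum>k\<le>s n. A * z ^ k)" .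
  have "(\<Sum>k\<le>s n. A * z ^ k) \<le> (\<Sum>k\<le>s n. A * z ^ (s n + 1))"
    using z assms(2) by (intro sum_mono mult_left_mono power_increasing) auto
  also have "\<dots> = real (s n + 1) * A * z ^ (s n + 1)" by simp
  also have "\<dots> \<le> 2 ^ (s n + 1) * A ^ (s n + 1) * z ^ (s n + 1)"
    using z assms(2) self_le_power[of A "s n + 1"] of_nat_less_two_power[of "s n + 1", where 'a = real]
    by (intro mult_mono) auto
  also have "\<dots> = (2 * A * z) ^ (s n + 1)" by (simp only: power_mult_distrib)
  finally show ?thesis using * bounded_combs_mono unfolding z_def by blast
qed

theorem corollary1p6:
  fixes f :: "complex fps" and s t :: "nat \<Rightarrow> nat" and \<alpha> :: complex and m :: nat
  assumes "generalized_liouville f s t"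
    and "algebraic_int \<alpha>"
    and "simple_algebraic \<alpha>"
    and "algebraic_degree \<alpha> = m"
    and "ereal (norm \<alpha>) < fps_conv_radius f"
    and "infinite {n. n \<ge> 1 \<and> poly (block_poly f s t n) \<alpha> \<noteq> 0}"
  shows "eval_fps f \<alpha> \<in> U_numbers m"
proof -
  note gl = generalized_liouvilleD[OF assms(1)]
  obtain p where p: "Polynomial.lead_coeff p = 1" "int_poly_at p \<alpha> = 0" "Polynomial.degree p = m"
    using algebraic_int_monic_minpoly[OF assms(2)] assms(4) by metis
  interpret monic_root \<alpha> m p by unfold_locales (use p in auto)
  obtain A D \<rho> where AD: "A \<ge> 1" "D \<ge> 1" and \<rho>: "0 < \<rho>" "\<rho> < 1"
    and coeff: "\<And>k. norm (fps_nth f k) \<le> A * D ^ k"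
    and terms: "\<And>k. norm (fps_nth f k * \<alpha> ^ k) \<le> A * \<rho> ^ k"
    using fps_coeff_bounds[OF assms(5)] by metis
  obtain R where R: "\<forall>n\<ge>1. s (Suc n) \<le> R * t n" using gl(5) by blast
  interpret liouville_approximation \<alpha> m p "partial_value f s \<alpha>" s t "eval_fps f \<alpha>" \<rho>
    "A / (1 - \<rho>)" "2 * A * (D * growth)" R
  proof unfold_locales
    show "1 \<le> A / (1 - \<rho>)" using AD \<rho> by (simp add: le_divide_eq)
    show "1 \<le> 2 * A * (D * growth)" using AD growth_ge_1 by (intro mult_ge1_I) auto
    show "norm (eval_fps f \<alpha> - partial_value f s \<alpha> n) \<le> A / (1 - \<rho>) * \<rho> ^ t n" if "n \<ge> 1" for n
      using partial_value_error[OF gl(3)[OF that] _ assms(5) \<rho> terms] gl(2)[OF that] by simp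
    show "partial_value f s \<alpha> n \<in> bounded_combs ((2 * A * (D * growth)) ^ (s n + 1))" for n
      by (rule partial_value_bounded_combs[OF gl(1) AD coeff])
    show "infinite {n. partial_value f s \<alpha> (Suc n) \<noteq> partial_value f s \<alpha> n}" (is "infinite ?N")
    proof
      assume "finite ?N"
      then have "finite (insert 1 (Suc ` ?N))" by simp
      \<comment> \<open>The block with index 1 is not a difference of two consecutive partial sums.\<close>
      moreover have "{n. n \<ge> 1 \<and> poly (block_poly f s t n) \<alpha> \<noteq> 0} \<subseteq> insert 1 (Suc ` ?N)"
      proof
        fix n assume "n \<in> {n. n \<ge> 1 \<and> poly (block_poly f s t n) \<alpha> \<noteq> 0}"
        then have n: "n \<ge> 1" "poly (block_poly f s t n) \<alpha> \<noteq> 0" by auto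
        show "n \<in> insert 1 (Suc ` ?N)"
        proof (cases "n = 1")
          case False
          then obtain k where k: "n = Suc k" "k \<ge> 1" using n(1) by (cases n) auto
          then have "k \<in> ?N" using partial_value_step[OF assms(1) k(2), of \<alpha>] n(2) by auto
          then show ?thesis using k(1) by blast
        qed simp
      qed
      ultimately show False using assms(6) finite_subset by blast
    qed
  qed (use assms(3,4) gl(2,4) R \<rho> in auto)
  show ?thesis by (rule limit_in_U_numbers)
qed

end
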